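(* Let $G$ be a finite simple graph on $n$ vertices such that both $G$ and its complement $\overline{G}$ are connected. Then $pc_{1,2}(G)+pc_{1,2}(\overline{G})\leq n+2$, and equality holds if and only if $G$ or $\overline{G}$ is isomorphic to a double star, i.e. $G\cong T(n_1,n_2)$ for some integers $n_1,n_2\geq 1$ or $\overline{G}\cong T(n_1,n_2)$ for some integers $n_1,n_2\geq 1$.
   Context: All graphs are finite, undirected, simple, and nontrivial (at least two vertices). An edge-coloring is an arbitrary map from the edge set to a set of colors (adjacent edges may receive the same color). In an edge-colored graph, a path $P$ is a distance $2$-proper path if no two edges of $P$ of the same color appear with fewer than $2$ edges in between on $P$; equivalently, any two distinct edges of $P$ that are consecutive on $P$ or separated by exactly one edge of $P$ have different colors. For a connected graph $G$, the $(1,2)$-proper connection number $pc_{1,2}(G)$ is the minimum number of colors in an edge-coloring of $G$ such that every two distinct vertices of $G$ are joined by a distance $2$-proper path in $G$. For $n_1,n_2\geq 1$, the double star $T(n_1,n_2)$ is the tree on $n_1+n_2+2$ vertices consisting of two adjacent center vertices $u,v$, with $n_1$ leaves attached to $u$ and $n_2$ leaves attached to $v$ (so the centers have degrees $n_1+1$ and $n_2+1$). *)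

theory Defs
  imports Main
begin

text \<open>
  A graph is given by its vertex set \<open>V\<close> and its set \<open>E\<close> of edges, where an
  edge is an unordered pair, that is, a two-element subset of \<open>V\<close>.
\<close>

locale fin_sgraph =
  fixes V :: "'a set" and E :: "'a set set"
  assumes finite_verts: "finite V"
    and edges: "e \<in> E \<Longrightarrow> e \<subseteq> V \<and> card e = 2"

definition complement_edges :: "'a set \<Rightarrow> 'a set set \<Rightarrow> 'a set set" where
  "complement_edges V E = {e. e \<subseteq> V \<and> card e = 2 \<and> e \<notin> E}"

definition path_edges :: "'a list \<Rightarrow> 'a set list" where
  "path_edges p = map2 (\<lambda>x y. {x, y}) p (tl p)"

definition path_between :: "'a set \<Rightarrow> 'a set set \<Rightarrow> 'a \<Rightarrow> 'a list \<Rightarrow> 'a \<Rightarrow> bool" where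
  "path_between V E x p y \<longleftrightarrow>
     p \<noteq> [] \<and> distinct p \<and> set p \<subseteq> V \<and> set (path_edges p) \<subseteq> E \<and> hd p = x \<and> last p = y"

definition connected_graph :: "'a set \<Rightarrow> 'a set set \<Rightarrow> bool" where
  "connected_graph V E \<longleftrightarrow> V \<noteq> {} \<and> (\<forall>x\<in>V. \<forall>y\<in>V. \<exists>p. path_between V E x p y)"

text \<open>
  The edges at positions \<open>i < j\<close> of a path have \<open>j - i - 1\<close> edges in between,
  and this number is less than 2 iff \<open>j \<le> i + 2\<close>.
\<close>

definition distance2_proper :: "('a set \<Rightarrow> 'c) \<Rightarrow> 'a list \<Rightarrow> bool" where
  "distance2_proper c p \<longleftrightarrow>
     (\<forall>i j. i < j \<and> j \<le> i + 2 \<and> j < length (path_edges p) \<longrightarrow>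
        c (path_edges p ! i) \<noteq> c (path_edges p ! j))"

definition proper_connecting_coloring ::
    "'a set \<Rightarrow> 'a set set \<Rightarrow> ('a set \<Rightarrow> 'c) \<Rightarrow> bool" where
  "proper_connecting_coloring V E c \<longleftrightarrow>
     (\<forall>x\<in>V. \<forall>y\<in>V. x \<noteq> y \<longrightarrow> (\<exists>p. path_between V E x p y \<and> distance2_proper c p))"

text \<open>
  Natural numbers suffice as colors because the graphs are finite. Only the
  values of \<open>c\<close> on \<open>E\<close> matter. If the graph is connected, a coloring that is
  injective on \<open>E\<close> qualifies, so the minimum exists.
\<close>

definition pc12 :: "'a set \<Rightarrow> 'a set set \<Rightarrow> nat" where
  "pc12 V E =
     (LEAST k. \<exists>c :: 'a set \<Rightarrow> nat. proper_connecting_coloring V E c \<and> card (c ` E) = k)"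

definition graph_iso :: "'a set \<Rightarrow> 'a set set \<Rightarrow> 'b set \<Rightarrow> 'b set set \<Rightarrow> bool" where
  "graph_iso V E W F \<longleftrightarrow>
     (\<exists>f. bij_betw f V W \<and> (\<forall>x\<in>V. \<forall>y\<in>V. {x, y} \<in> E \<longleftrightarrow> {f x, f y} \<in> F))"

text \<open>
  The double star \<open>T(m, n)\<close> on the vertices \<open>0, \<dots>, m + n + 1\<close>: its centers are 0
  and 1, the \<open>m\<close> leaves at 0 are \<open>2, \<dots>, m + 1\<close>, and the \<open>n\<close> leaves at 1 are
  \<open>m + 2, \<dots>, m + n + 1\<close>.
\<close>

definition double_star_verts :: "nat \<Rightarrow> nat \<Rightarrow> nat set" where
  "double_star_verts m n = {..<m + n + 2}"

definition double_star_edges :: "nat \<Rightarrow> nat \<Rightarrow> nat set set" where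
  "double_star_edges m n =
     {{0, 1}} \<union> {{0, i} | i. i \<in> {2..<m + 2}} \<union> {{1, j} | j. j \<in> {m + 2..<m + n + 2}}"

definition is_double_star :: "'a set \<Rightarrow> 'a set set \<Rightarrow> bool" where
  "is_double_star V E \<longleftrightarrow>
     (\<exists>m\<ge>1. \<exists>n\<ge>1. graph_iso V E (double_star_verts m n) (double_star_edges m n))"

end

(*
  Let H be the complement of G. A connected graph on n vertices that contains a path with
  five vertices has pc_{1,2} at most n - 2: color that path 0, 1, 2, 0 and attach the other
  vertices one by one with fresh colors. If G has no such path and H is connected, then G is
  a double star, where all n - 1 edges need different colors while H needs exactly 3.

  So it remains to see that pc_{1,2} of G or of H is at most 3 when n >= 6. If the vertices of
  a subgraph carry labels modulo 3 such that the arcs from label i to label i + 1 form a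
  strongly connected digraph (a "core"), then coloring each arc by the label of its tail makes
  directed paths distance 2-proper. By R(3,3) = 6 one of G, H contains a triangle, hence a core;
  take a largest core K over both graphs, say in G. Vertices with two neighbors in K are easily
  connected to K, so only the set D of the other vertices outside K matters. If D is a clique,
  3 colors suffice. If x, y in D are not adjacent, then {x, y} together with their common
  non-neighbors in K is a core of H, so by maximality it has the same size, and maximality
  of both cores determines the adjacencies well enough to split D into two cliques, one joined
  to K by outgoing arcs and the other by incoming arcs.
*)

theory Submission
  imports Defs
begin

section \<open>Paths\<close>

lemma length_path_edges [simp]: "length (path_edges p) = length p - 1"
  by (simp add: path_edges_def)

lemma nth_path_edges: "Suc i < length p \<Longrightarrow> path_edges p ! i = {p ! i, p ! Suc i}"
  by (simp add: path_edges_def nth_tl)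

lemma path_edges_subset_iff:
  "set (path_edges p) \<subseteq> E \<longleftrightarrow> (\<forall>i. Suc i < length p \<longrightarrow> {p ! i, p ! Suc i} \<in> E)"
proof -
  have "set (path_edges p) \<subseteq> E \<longleftrightarrow> (\<forall>i < length (path_edges p). path_edges p ! i \<in> E)"
    unfolding subset_iff in_set_conv_nth by blast
  also have "\<dots> \<longleftrightarrow> (\<forall>i. Suc i < length p \<longrightarrow> {p ! i, p ! Suc i} \<in> E)"
    by (simp add: nth_path_edges less_diff_conv)
  finally show ?thesis .
qed

lemma distance2_proper_iff:
  "distance2_proper c p \<longleftrightarrow>
     (\<forall>i j. i < j \<and> j \<le> i + 2 \<and> Suc j < length p \<longrightarrow>
        c {p ! i, p ! Suc i} \<noteq> c {p ! j, p ! Suc j})"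
proof -
  have "(j < length (path_edges p) \<longrightarrow> c (path_edges p ! i) \<noteq> c (path_edges p ! j)) \<longleftrightarrow>
      (Suc j < length p \<longrightarrow> c {p ! i, p ! Suc i} \<noteq> c {p ! j, p ! Suc j})" if "i < j" for i j
    using that by (simp add: nth_path_edges less_diff_conv)
  then show ?thesis unfolding distance2_proper_def by blast
qed

text \<open>Isolates the requirement for one pair of vertices, so that it can be proved pair by pair
  and carried over to larger graphs and changed colorings.\<close>

definition linked :: "'a set \<Rightarrow> 'a set set \<Rightarrow> ('a set \<Rightarrow> 'c) \<Rightarrow> 'a \<Rightarrow> 'a \<Rightarrow> bool" where
  "linked V E c x y \<longleftrightarrow> (\<exists>p. path_between V E x p y \<and> distance2_proper c p)"

lemma linkedI:
  assumes "p \<noteq> []" "distinct p" "set p \<subseteq> V" "hd p = x" "last p = y"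
    and "\<And>i. Suc i < length p \<Longrightarrow> {p ! i, p ! Suc i} \<in> E"
    and "\<And>i j. i < j \<Longrightarrow> j \<le> i + 2 \<Longrightarrow> Suc j < length p \<Longrightarrow>
           c {p ! i, p ! Suc i} \<noteq> c {p ! j, p ! Suc j}"
  shows "linked V E c x y"
  unfolding linked_def path_between_def distance2_proper_iff path_edges_subset_iff
  using assms by blast

lemma linkedE:
  assumes "linked V E c x y"
  obtains p where "p \<noteq> []" "distinct p" "set p \<subseteq> V" "hd p = x" "last p = y"
    and "\<And>i. Suc i < length p \<Longrightarrow> {p ! i, p ! Suc i} \<in> E"
    and "\<And>i j. i < j \<Longrightarrow> j \<le> i + 2 \<Longrightarrow> Suc j < length p \<Longrightarrow>
           c {p ! i, p ! Suc i} \<noteq> c {p ! j, p ! Suc j}"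
  using assms
  unfolding linked_def path_between_def distance2_proper_iff path_edges_subset_iff
  by blast

lemma linked_sym:
  assumes "linked V E c x y"
  shows "linked V E c y x"
proof -
  obtain p where p: "p \<noteq> []" "distinct p" "set p \<subseteq> V" "hd p = x" "last p = y"
    and e: "\<And>i. Suc i < length p \<Longrightarrow> {p ! i, p ! Suc i} \<in> E"
    and c: "\<And>i j. i < j \<Longrightarrow> j \<le> i + 2 \<Longrightarrow> Suc j < length p \<Longrightarrow>
           c {p ! i, p ! Suc i} \<noteq> c {p ! j, p ! Suc j}"
    using linkedE[OF assms] by metis
  \<comment> \<open>Edge \<open>i\<close> of the reversed path is edge
    \<open>length p - 2 - i\<close> of the original one.\<close>
  have r: "{rev p ! i, rev p ! Suc i}
      = {p ! (length p - Suc (Suc i)), p ! Suc (length p - Suc (Suc i))}"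
    if "Suc i < length p" for i
    using that by (auto simp: rev_nth Suc_diff_Suc)
  show ?thesis
  proof (rule linkedI[of "rev p"])
    show "{rev p ! i, rev p ! Suc i} \<in> E" if "Suc i < length (rev p)" for i
      using that by (simp only: r length_rev) (rule e, simp)
    show "c {rev p ! i, rev p ! Suc i} \<noteq> c {rev p ! j, rev p ! Suc j}"
      if "i < j" "j \<le> i + 2" "Suc j < length (rev p)" for i j
    proof -
      have l: "Suc i < length p" "Suc j < length p"
        using that by auto
      have "c {p ! (length p - Suc (Suc j)), p ! Suc (length p - Suc (Suc j))}
         \<noteq> c {p ! (length p - Suc (Suc i)), p ! Suc (length p - Suc (Suc i))}"
        by (rule c) (use that in auto)
      then show ?thesis
        unfolding r[OF l(1)] r[OF l(2)] by metis
    qed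
  qed (use p in \<open>auto simp: hd_rev last_rev\<close>)
qed

lemma linked_edge: "{x, y} \<in> E \<Longrightarrow> x \<noteq> y \<Longrightarrow> x \<in> V \<Longrightarrow> y \<in> V \<Longrightarrow> linked V E c x y"
  by (rule linkedI[of "[x, y]"]) auto

text \<open>The added last edge has a color that differs from all colors on \<open>F\<close>, hence
  from the two edges before it, and \<open>w\<close> is a new vertex because the old path stays
  inside \<open>U\<close>.\<close>

lemma linked_snoc:
  assumes "linked U F c x p" and "U \<subseteq> V" "F \<subseteq> E"
    and "w \<in> V" "w \<notin> U" "{p, w} \<in> E"
    and "\<And>e. e \<in> F \<Longrightarrow> c' e = c e" and "\<And>e. e \<in> F \<Longrightarrow> c' {p, w} \<noteq> c e"
  shows "linked V E c' x w"
proof -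
  obtain q where q: "q \<noteq> []" "distinct q" "set q \<subseteq> U" "hd q = x" "last q = p"
    and e: "\<And>i. Suc i < length q \<Longrightarrow> {q ! i, q ! Suc i} \<in> F"
    and c: "\<And>i j. i < j \<Longrightarrow> j \<le> i + 2 \<Longrightarrow> Suc j < length q \<Longrightarrow>
           c {q ! i, q ! Suc i} \<noteq> c {q ! j, q ! Suc j}"
    using linkedE[OF assms(1)] by metis
  let ?r = "q @ [w]"
  have old: "{?r ! i, ?r ! Suc i} = {q ! i, q ! Suc i}" if "Suc i < length q" for i
    using that by (simp add: nth_append)
  have new: "{?r ! i, ?r ! Suc i} = {p, w}" if "Suc i = length q" for i
  proof -
    have "q ! i = p" using that q(1,5) by (metis diff_Suc_1 last_conv_nth)
    then show ?thesis using that by (simp add: nth_append flip: that)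
  qed
  show ?thesis
  proof (rule linkedI[of ?r])
    show "{?r ! i, ?r ! Suc i} \<in> E" if "Suc i < length ?r" for i
    proof (cases "Suc i = length q")
      case True
      then show ?thesis using new assms by metis
    next
      case False
      then have "Suc i < length q" using that by simp
      then show ?thesis using old e assms(3) by auto
    qed
    show "c' {?r ! i, ?r ! Suc i} \<noteq> c' {?r ! j, ?r ! Suc j}"
      if "i < j" "j \<le> i + 2" "Suc j < length ?r" for i j
    proof -
      have i: "Suc i < length q" using that by simp
      have ci: "c' {?r ! i, ?r ! Suc i} = c {q ! i, q ! Suc i}"
        unfolding old[OF i] using assms(7) e[OF i] by blast
      show ?thesis
      proof (cases "Suc j = length q")
        case True
        then show ?thesis unfolding ci new[OF True] using assms(8) e[OF i] by metis
      next
        case False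
        then have j: "Suc j < length q" using that by simp
        have "c' {?r ! j, ?r ! Suc j} = c {q ! j, q ! Suc j}"
          unfolding old[OF j] using assms(7) e[OF j] by blast
        then show ?thesis unfolding ci using c[OF that(1,2) j] by metis
      qed
    qed
  qed (use q assms in auto)
qed

lemma linked_mono:
  assumes "linked U F c x y" "U \<subseteq> V" "F \<subseteq> E" "\<And>e. e \<in> F \<Longrightarrow> c' e = c e"
  shows "linked V E c' x y"
proof -
  obtain q where q: "q \<noteq> []" "distinct q" "set q \<subseteq> U" "hd q = x" "last q = y"
    and e: "\<And>i. Suc i < length q \<Longrightarrow> {q ! i, q ! Suc i} \<in> F"
    and c: "\<And>i j. i < j \<Longrightarrow> j \<le> i + 2 \<Longrightarrow> Suc j < length q \<Longrightarrow>
           c {q ! i, q ! Suc i} \<noteq> c {q ! j, q ! Suc j}"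
    using linkedE[OF assms(1)] by metis
  show ?thesis
  proof (rule linkedI[of q])
    show "c' {q ! i, q ! Suc i} \<noteq> c' {q ! j, q ! Suc j}"
      if "i < j" "j \<le> i + 2" "Suc j < length q" for i j
      using c[OF that] assms(4)[OF e[of i]] assms(4)[OF e[of j]] that by simp
  qed (use q e assms in auto)
qed

lemma proper_connecting_coloring_iff_linked:
  "proper_connecting_coloring V E c \<longleftrightarrow> (\<forall>x\<in>V. \<forall>y\<in>V. x \<noteq> y \<longrightarrow> linked V E c x y)"
  by (simp add: proper_connecting_coloring_def linked_def)

lemma pc12_le:
  fixes c :: "'a set \<Rightarrow> nat"
  assumes "proper_connecting_coloring V E c" "card (c ` E) \<le> k"
  shows "pc12 V E \<le> k"
proof -
  have "pc12 V E \<le> card (c ` E)"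
    unfolding pc12_def using assms(1) by (intro Least_le) blast
  then show ?thesis using assms(2) by simp
qed

text \<open>The given coloring guarantees that the least value is attained; without one,
  \<open>LEAST\<close> would be unspecified.\<close>

lemma pc12_ge:
  fixes c :: "'a set \<Rightarrow> nat"
  assumes "proper_connecting_coloring V E c"
    and "\<And>c :: 'a set \<Rightarrow> nat. proper_connecting_coloring V E c \<Longrightarrow> k \<le> card (c ` E)"
  shows "k \<le> pc12 V E"
proof -
  have "\<exists>c :: 'a set \<Rightarrow> nat. proper_connecting_coloring V E c \<and> card (c ` E) = pc12 V E"
    unfolding pc12_def by (rule LeastI_ex) (use assms(1) in blast)
  then show ?thesis using assms(2) by metis
qed

section \<open>Colorings from labeled arcs\<close>

lemma mod3_Suc_neq:
  fixes a b c :: nat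
  assumes "b mod 3 = Suc a mod 3"
  shows "a mod 3 \<noteq> b mod 3"
  using assms by presburger
lemma mod3_Suc_Suc_neq:
  fixes a b c :: nat
  assumes "b mod 3 = Suc a mod 3" "c mod 3 = Suc b mod 3"
  shows "a mod 3 \<noteq> c mod 3"
proof -
  have "c mod 3 = Suc (Suc a) mod 3" using assms by (metis mod_Suc_eq)
  then show ?thesis by presburger
qed

text \<open>A directed walk is kept simple while it grows: if the next vertex already occurs on the
  list, the list is cut off at that occurrence.\<close>

lemma rtrancl_distinct_list:
  assumes "(x, y) \<in> A\<^sup>*"
  shows "\<exists>p. p \<noteq> [] \<and> distinct p \<and> hd p = x \<and> last p = y \<and>
           (\<forall>i. Suc i < length p \<longrightarrow> (p ! i, p ! Suc i) \<in> A)"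
  using assms
proof (induction rule: rtrancl_induct)
  case base
  show ?case by (intro exI[of _ "[x]"]) auto
next
  case (step y z)
  then obtain p where p: "p \<noteq> []" "distinct p" "hd p = x" "last p = y"
    and A: "\<And>i. Suc i < length p \<Longrightarrow> (p ! i, p ! Suc i) \<in> A" by blast
  show ?case
  proof (cases "z \<in> set p")
    case True
    then obtain q r where qr: "p = q @ z # r" by (meson split_list)
    have "((q @ [z]) ! i, (q @ [z]) ! Suc i) \<in> A" if "Suc i < length (q @ [z])" for i
    proof -
      have "(q @ [z]) ! k = p ! k" if "k < length (q @ [z])" for k
        using that by (auto simp: qr nth_append)
      then show ?thesis using that A[of i] by (simp add: qr)
    qed
    moreover have "hd (q @ [z]) = x" using p(3) by (cases q) (auto simp: qr)
    ultimately show ?thesis using p(2) by (intro exI[of _ "q @ [z]"]) (auto simp: qr)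
  next
    case False
    have "((p @ [z]) ! i, (p @ [z]) ! Suc i) \<in> A" if "Suc i < length (p @ [z])" for i
    proof (cases "Suc i = length p")
      case True
      then have "p ! i = y" using p by (simp add: last_conv_nth flip: True)
      then show ?thesis using step(2) True by (simp add: nth_append flip: True)
    next
      case False
      then show ?thesis using that A[of i] by (simp add: nth_append)
    qed
    then show ?thesis using p False by (intro exI[of _ "p @ [z]"]) auto
  qed
qed

text \<open>
  Coloring every arc by the label of its tail makes three consecutive edges of a
  directed path receive three different colors, because labels increase by 1
  modulo 3 along the arcs in \<open>A\<close>. The arcs in \<open>B\<close> may only be used as last arcs,
  so no condition on the labels of their heads is needed.
\<close>

lemma increasing_coloring:
  fixes lab :: "'a \<Rightarrow> nat"
  assumes A: "\<And>x y. (x, y) \<in> A \<Longrightarrow> {x, y} \<in> E \<and> x \<in> V \<and> y \<in> V \<and> lab y mod 3 = Suc (lab x) mod 3"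
    and B: "\<And>x y. (x, y) \<in> B \<Longrightarrow> {x, y} \<in> E \<and> x \<in> V \<and> y \<in> V \<and> (y, x) \<notin> A \<union> B"
    and conn: "\<And>x y. x \<in> V \<Longrightarrow> y \<in> V \<Longrightarrow> x \<noteq> y \<Longrightarrow>
       {x, y} \<in> E \<or> (x, y) \<in> A\<^sup>* O B\<^sup>= \<or> (y, x) \<in> A\<^sup>* O B\<^sup>="
  shows "\<exists>c :: 'a set \<Rightarrow> nat. proper_connecting_coloring V E c \<and> range c \<subseteq> {0, 1, 2}"
proof -
  \<comment> \<open>The color is computed from an unordered edge, so the tail is recovered by
    choice; \<open>asym\<close> below makes it unique. Edges that carry no arc get the default 0 and
    serve only as paths of length one.\<close>
  define c :: "'a set \<Rightarrow> nat" where
    "c = (\<lambda>e. if \<exists>x y. (x, y) \<in> A \<union> B \<and> e = {x, y}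
              then lab (SOME x. \<exists>y. (x, y) \<in> A \<union> B \<and> e = {x, y}) mod 3 else 0)"
  \<comment> \<open>Opposite arcs in \<open>A\<close> would raise a label by 2 and return to the
    same residue modulo 3; all other combinations are excluded by the assumption on
    \<open>B\<close>.\<close>
  have asym: "(y, x) \<notin> A \<union> B" if "(x, y) \<in> A \<union> B" for x y
  proof
    assume yx: "(y, x) \<in> A \<union> B"
    have "(x, y) \<notin> B" using B[of x y] yx by blast
    moreover have "(y, x) \<notin> B" using B[of y x] that by blast
    ultimately have "(x, y) \<in> A \<and> (y, x) \<in> A" using that yx by blast
    then have "lab y mod 3 = Suc (lab x) mod 3" "lab x mod 3 = Suc (lab y) mod 3"
      using A by blast+
    then show False by presburger
  qed
  have c: "c {x, y} = lab x mod 3" if "(x, y) \<in> A \<union> B" for x y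
  proof -
    have "(SOME x'. \<exists>y'. (x', y') \<in> A \<union> B \<and> {x, y} = {x', y'}) = x"
    proof (rule some_equality)
      show "\<exists>y'. (x, y') \<in> A \<union> B \<and> {x, y} = {x, y'}" using that by blast
      show "x' = x" if "\<exists>y'. (x', y') \<in> A \<union> B \<and> {x, y} = {x', y'}" for x'
        using that asym[OF \<open>(x, y) \<in> A \<union> B\<close>] by (metis doubleton_eq_iff)
    qed
    moreover have "\<exists>x' y'. (x', y') \<in> A \<union> B \<and> {x, y} = {x', y'}" using that by blast
    ultimately show ?thesis unfolding c_def by (simp only: if_True)
  qed
  have link: "linked V E c x y" if xy: "(x, y) \<in> A\<^sup>* O B\<^sup>=" "x \<in> V" for x y
  proof -
    have "\<exists>p. p \<noteq> [] \<and> distinct p \<and> hd p = x \<and> last p = y \<and>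
           (\<forall>i. Suc i < length p \<longrightarrow> (p ! i, p ! Suc i) \<in> A \<or>
               (p ! i, p ! Suc i) \<in> B \<and> Suc (Suc i) = length p)"
    proof (cases "(x, y) \<in> A\<^sup>*")
      case True
      then show ?thesis using rtrancl_distinct_list[OF True] by blast
    next
      case False
      then obtain z where z: "(x, z) \<in> A\<^sup>*" "(z, y) \<in> B" using xy by auto
      then obtain p where p: "p \<noteq> []" "distinct p" "hd p = x" "last p = z"
        and pA: "\<And>i. Suc i < length p \<Longrightarrow> (p ! i, p ! Suc i) \<in> A"
        using rtrancl_distinct_list[OF z(1)] by blast
      have reach: "k < length p \<Longrightarrow> (x, p ! k) \<in> A\<^sup>*" for k
      proof (induction k)
        case 0
        then show ?case using p by (simp add: hd_conv_nth)
      next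
        case (Suc k)
        then show ?case using pA[of k] by (meson Suc_lessD rtrancl.rtrancl_into_rtrancl)
      qed
      \<comment> \<open>All vertices of \<open>p\<close> are reachable from \<open>x\<close> in
        \<open>A\<close>, while \<open>y\<close> is not in this case; so the final arc in
        \<open>B\<close> leads to a new vertex.\<close>
      have y: "y \<notin> set p" using reach False by (metis in_set_conv_nth)
      have "((p @ [y]) ! i, (p @ [y]) ! Suc i) \<in> A \<or>
               ((p @ [y]) ! i, (p @ [y]) ! Suc i) \<in> B \<and> Suc (Suc i) = length (p @ [y])"
        if "Suc i < length (p @ [y])" for i
      proof (cases "Suc i = length p")
        case True
        then have "p ! i = z" using p by (simp add: last_conv_nth flip: True)
        then show ?thesis using z(2) True by (simp add: nth_append flip: True)
      next
        case False
        then show ?thesis using that pA[of i] by (simp add: nth_append)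
      qed
      then show ?thesis using p y by (intro exI[of _ "p @ [y]"]) auto
    qed
    then obtain p where p: "p \<noteq> []" "distinct p" "hd p = x" "last p = y"
      and pAB: "\<And>i. Suc i < length p \<Longrightarrow> (p ! i, p ! Suc i) \<in> A \<or>
               (p ! i, p ! Suc i) \<in> B \<and> Suc (Suc i) = length p" by blast
    \<comment> \<open>The bound leaves out the last edge, whose arc may lie in \<open>B\<close> and
      have a head with any label. This suffices because colors depend on tails only.\<close>
    have inc: "lab (p ! Suc i) mod 3 = Suc (lab (p ! i)) mod 3" if "Suc (Suc i) < length p" for i
      using pAB[of i] that A[of "p ! i" "p ! Suc i"] by auto
    have col: "c {p ! i, p ! Suc i} = lab (p ! i) mod 3" if "Suc i < length p" for i
      using pAB[OF that] c by blast
    show ?thesis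
    proof (rule linkedI[of p])
      show "{p ! i, p ! Suc i} \<in> E" if "Suc i < length p" for i
        using pAB[OF that] A B by blast
      show "set p \<subseteq> V"
      proof
        fix v assume "v \<in> set p"
        then obtain k where k: "k < length p" "p ! k = v" by (auto simp: in_set_conv_nth)
        show "v \<in> V"
        proof (cases k)
          case 0
          then show ?thesis using k p xy by (simp add: hd_conv_nth)
        next
          case (Suc i)
          then show ?thesis using k pAB[of i] A B by blast
        qed
      qed
      show "c {p ! i, p ! Suc i} \<noteq> c {p ! j, p ! Suc j}"
        if ij: "i < j" "j \<le> i + 2" "Suc j < length p" for i j
      proof -
        have "Suc i < length p" using ij by simp
        consider "j = Suc i" | "j = Suc (Suc i)" using ij by linarith
        then have "lab (p ! i) mod 3 \<noteq> lab (p ! j) mod 3"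
        proof cases
          case 1
          then show ?thesis using mod3_Suc_neq[OF inc[of i]] ij by simp
        next
          case 2
          then show ?thesis using mod3_Suc_Suc_neq[OF inc[of i] inc[of "Suc i"]] ij by simp
        qed
        then show ?thesis using col[OF \<open>Suc i < length p\<close>] col[OF ij(3)] by simp
      qed
    qed (use p in auto)
  qed
  have "proper_connecting_coloring V E c"
    unfolding proper_connecting_coloring_iff_linked
  proof (intro ballI impI)
    fix x y assume xy: "x \<in> V" "y \<in> V" "x \<noteq> y"
    from conn[OF this] show "linked V E c x y"
    proof (elim disjE)
      assume "{x, y} \<in> E"
      then show ?thesis by (rule linked_edge) (use xy in auto)
    next
      assume "(x, y) \<in> A\<^sup>* O B\<^sup>="
      then show ?thesis by (rule link) (use xy in auto)
    next
      assume "(y, x) \<in> A\<^sup>* O B\<^sup>="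
      then show ?thesis by (intro linked_sym[OF link]) (use xy in auto)
    qed
  qed
  moreover have "range c \<subseteq> {0, 1, 2}"
  proof -
    have "n mod 3 \<in> {0, 1, 2}" for n :: nat
      using mod_less_divisor[of 3 n] by auto
    then have "c e \<in> {0, 1, 2}" for e
      unfolding c_def by (simp only: insert_iff simp_thms split: if_split)
    then show ?thesis by (rule image_subsetI)
  qed
  ultimately show ?thesis by blast
qed

section \<open>Growing a coloring with fresh colors\<close>

text \<open>A path from a vertex inside \<open>U\<close> to one outside must leave \<open>U\<close>
  at some edge.\<close>

lemma connected_boundary_edge:
  assumes "connected_graph V E" "U \<subseteq> V" "U \<noteq> {}" "U \<noteq> V"
  obtains p w where "p \<in> U" "w \<in> V" "w \<notin> U" "{p, w} \<in> E"
proof -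
  obtain x y where xy: "x \<in> U" "y \<in> V" "y \<notin> U" using assms by blast
  then obtain q where q: "path_between V E x q y"
    using assms unfolding connected_graph_def by (meson subsetD)
  then have q': "q \<noteq> []" "set q \<subseteq> V" "hd q = x" "last q = y"
    "\<And>i. Suc i < length q \<Longrightarrow> {q ! i, q ! Suc i} \<in> E"
    unfolding path_between_def path_edges_subset_iff by auto
  have "\<exists>i. Suc i < length q \<and> q ! i \<in> U \<and> q ! Suc i \<notin> U"
  proof (rule ccontr)
    assume n: "\<not> ?thesis"
    have "i < length q \<Longrightarrow> q ! i \<in> U" for i
    proof (induction i)
      case 0
      then show ?case using q' xy by (simp add: hd_conv_nth)
    next
      case (Suc i)
      then show ?case using n by auto
    qed
    then have "last q \<in> U" using q'(1) by (metis diff_less last_conv_nth length_greater_0_conv zero_less_one)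
    then show False using q' xy by simp
  qed
  then obtain i where "Suc i < length q" "q ! i \<in> U" "q ! Suc i \<notin> U" by blast
  then show ?thesis using q' that by (meson nth_mem subsetD)
qed

text \<open>Each vertex outside \<open>U\<close> is attached by one edge with a fresh color. A step
  adds one vertex and at most one color, so the surplus \<open>d\<close> of vertices over colors
  survives. Colors are counted by \<open>range c\<close>, which makes a fresh color new for every
  edge.\<close>

lemma grow_coloring:
  fixes c :: "'a set \<Rightarrow> nat"
  assumes "finite V" "connected_graph V E"
    and "U \<subseteq> V" "U \<noteq> {}" "proper_connecting_coloring U (E \<inter> Pow U) c"
    and "finite (range c)" "card (range c) + d \<le> card U"
  shows "\<exists>c' :: 'a set \<Rightarrow> nat. proper_connecting_coloring V E c' \<and> card (c' ` E) + d \<le> card V"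
  using assms(3-)
proof (induction "card (V - U)" arbitrary: U c)
  case 0
  then have U: "U = V" using assms(1) by (auto simp: card_eq_0_iff)
  have "proper_connecting_coloring V E c"
    using 0(4) unfolding U proper_connecting_coloring_iff_linked
    using linked_mono[of V "E \<inter> Pow V" c _ _ V E c] by blast
  moreover have "card (c ` E) \<le> card (range c)"
    using 0 by (intro card_mono) auto
  ultimately show ?case using 0 U by (intro exI[of _ c]) auto
next
  case (Suc m)
  then have "U \<noteq> V" by auto
  then obtain p w where pw: "p \<in> U" "w \<in> V" "w \<notin> U" "{p, w} \<in> E"
    using connected_boundary_edge[OF assms(2) Suc.prems(1,2)] by metis
  obtain k where k: "k \<notin> range c"
    using Suc.prems by (meson ex_new_if_finite infinite_UNIV_nat)
  define c' where "c' = c({p, w} := k)"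
  define U' where "U' = insert w U"
  have finU: "finite U" using Suc.prems assms(1) finite_subset by auto
  have F: "e \<in> E \<inter> Pow U \<Longrightarrow> c' e = c e" for e
    using pw by (auto simp: c'_def)
  have mono: "U \<subseteq> U'" "E \<inter> Pow U \<subseteq> E \<inter> Pow U'"
    by (auto simp: U'_def)
  have new: "linked U' (E \<inter> Pow U') c' x w" if "x \<in> U" for x
  proof (cases "x = p")
    case True
    then show ?thesis using pw by (intro linked_edge) (auto simp: U'_def)
  next
    case False
    show ?thesis
    proof (rule linked_snoc)
      show "linked U (E \<inter> Pow U) c x p"
        using Suc.prems that pw False by (simp add: proper_connecting_coloring_iff_linked)
      show "c' {p, w} \<noteq> c e" for e using k by (auto simp: c'_def)
    qed (use mono F pw in \<open>auto simp: U'_def\<close>)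
  qed
  have "proper_connecting_coloring U' (E \<inter> Pow U') c'"
    unfolding proper_connecting_coloring_iff_linked
  proof (intro ballI impI)
    fix x y assume xy: "x \<in> U'" "y \<in> U'" "x \<noteq> y"
    consider "x \<in> U" "y \<in> U" | "x \<in> U" "y = w" | "x = w" "y \<in> U"
      using xy by (auto simp: U'_def)
    then show "linked U' (E \<inter> Pow U') c' x y"
    proof cases
      case 1
      then have "linked U (E \<inter> Pow U) c x y"
        using Suc.prems xy by (simp add: proper_connecting_coloring_iff_linked)
      then show ?thesis by (rule linked_mono) (use mono F in auto)
    next
      case 2
      then show ?thesis using new by simp
    next
      case 3
      then show ?thesis using linked_sym[OF new[of y]] by simp
    qed
  qed
  moreover have r: "range c' \<subseteq> insert k (range c)"
    by (auto simp: c'_def)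
  moreover have "card (range c') \<le> Suc (card (range c))"
    using card_mono[OF _ r] Suc.prems by (simp add: k)
  moreover have "card U' = Suc (card U)" using finU pw by (simp add: U'_def)
  moreover have "m = card (V - U')"
  proof -
    have "V - U' = (V - U) - {w}" by (auto simp: U'_def)
    then show ?thesis using Suc.hyps(2) pw assms(1) by simp
  qed
  moreover have "finite (range c')" using finite_subset[OF r] Suc.prems by simp
  moreover have "U' \<subseteq> V" "U' \<noteq> {}" using Suc.prems pw by (auto simp: U'_def)
  moreover have "card (range c') + d \<le> card U'" using calculation Suc.prems(5) by linarith
  ultimately show ?case
    by (intro Suc.hyps(1)[of U' c'])
qed

text \<open>Growth starts from a single edge: two vertices, one color, hence surplus 1.\<close>

lemma proper_connecting_coloring_exists:
  assumes "finite V" "connected_graph V E" "card V \<ge> 2"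
  shows "\<exists>c :: 'a set \<Rightarrow> nat. proper_connecting_coloring V E c \<and> card (c ` E) + 1 \<le> card V"
proof -
  obtain u where u: "u \<in> V" using assms(2) unfolding connected_graph_def by blast
  have "{u} \<noteq> V" using assms(3) by auto
  then obtain w where w: "w \<in> V" "w \<noteq> u" "{u, w} \<in> E"
    using connected_boundary_edge[OF assms(2), of "{u}"] u by auto
  show ?thesis
  proof (rule grow_coloring[OF assms(1,2), of "{u, w}" "\<lambda>_. 0"])
    show "proper_connecting_coloring {u, w} (E \<inter> Pow {u, w}) (\<lambda>_. 0 :: nat)"
      unfolding proper_connecting_coloring_iff_linked
      using w by (auto intro!: linked_edge simp: insert_commute)
  qed (use u w in auto)
qed

section \<open>Paths on five vertices\<close>

definition has_path5 :: "'a set \<Rightarrow> 'a set set \<Rightarrow> bool" where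
  "has_path5 V E \<longleftrightarrow> (\<exists>a b c d e. {a, b, c, d, e} \<subseteq> V \<and> distinct [a, b, c, d, e] \<and>
     {a, b} \<in> E \<and> {b, c} \<in> E \<and> {c, d} \<in> E \<and> {d, e} \<in> E)"

text \<open>The path itself needs only three colors for its five vertices, and growing preserves
  this surplus of 2.\<close>

lemma pc12_le_if_has_path5:
  assumes "finite V" "connected_graph V E" "has_path5 V E"
  shows "pc12 V E + 2 \<le> card V"
proof -
  obtain a b c d e where p: "{a, b, c, d, e} \<subseteq> V" "distinct [a, b, c, d, e]"
     "{a, b} \<in> E" "{b, c} \<in> E" "{c, d} \<in> E" "{d, e} \<in> E"
    using assms(3) unfolding has_path5_def by blast
  let ?U = "{a, b, c, d, e}"
  \<comment> \<open>The labels along the path are 0, 1, 2, 0, 1; \<open>a\<close> and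
    \<open>d\<close> take the default 0.\<close>
  define lab :: "'a \<Rightarrow> nat" where
    "lab = (\<lambda>_. 0)(b := 1, c := 2, e := 1)"
  define A where "A = {(a, b), (b, c), (c, d), (d, e)}"
  have ab: "(a, b) \<in> A\<^sup>*" and bc: "(b, c) \<in> A\<^sup>*" and cd: "(c, d) \<in> A\<^sup>*" and de: "(d, e) \<in> A\<^sup>*"
    by (auto simp: A_def intro: r_into_rtrancl)
  note trans = ab bc cd de rtrancl_trans[OF ab bc] rtrancl_trans[OF bc cd]
    rtrancl_trans[OF cd de] rtrancl_trans[OF rtrancl_trans[OF ab bc] cd]
    rtrancl_trans[OF rtrancl_trans[OF bc cd] de]
    rtrancl_trans[OF rtrancl_trans[OF rtrancl_trans[OF ab bc] cd] de]
  have "\<exists>f :: 'a set \<Rightarrow> nat. proper_connecting_coloring ?U (E \<inter> Pow ?U) f \<and> range f \<subseteq> {0, 1, 2}"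
  proof (rule increasing_coloring[where B = "{}" and lab = lab])
    show "{x, y} \<in> E \<inter> Pow ?U \<and> x \<in> ?U \<and> y \<in> ?U \<and> lab y mod 3 = Suc (lab x) mod 3"
      if "(x, y) \<in> A" for x y
      using that p by (auto simp: A_def lab_def)
    show "{x, y} \<in> E \<inter> Pow ?U \<or> (x, y) \<in> A\<^sup>* O {}\<^sup>= \<or> (y, x) \<in> A\<^sup>* O {}\<^sup>="
      if "x \<in> ?U" "y \<in> ?U" "x \<noteq> y" for x y
    proof -
      have "(x, y) \<in> A\<^sup>* \<or> (y, x) \<in> A\<^sup>*"
        using that(1,2) by (elim insertE emptyE; simp only: trans that(3) rtrancl.rtrancl_refl simp_thms)
      then show ?thesis by blast
    qed
  qed auto
  then obtain f :: "'a set \<Rightarrow> nat" where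
    pc: "proper_connecting_coloring ?U (E \<inter> Pow ?U) f" and r: "range f \<subseteq> {0, 1, 2}" by blast
  have "card (range f) \<le> card {0, 1, 2 :: nat}" by (rule card_mono[OF _ r]) simp
  then obtain c' :: "'a set \<Rightarrow> nat" where
    "proper_connecting_coloring V E c'" "card (c' ` E) + 2 \<le> card V"
    using grow_coloring[OF assms(1,2) p(1) _ pc, of 2] p(2) finite_subset[OF r] by auto
  then show ?thesis using pc12_le[of V E c' "card (c' ` E)"] by simp
qed

section \<open>Double stars\<close>

text \<open>Writing the leaf edges as images of \<open>A\<close> and \<open>B\<close> lets vertex
  maps pass through to the centers and leaf sets.\<close>

definition star_pair :: "'a \<Rightarrow> 'a \<Rightarrow> 'a set \<Rightarrow> 'a set \<Rightarrow> 'a set set" where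
  "star_pair u v A B = insert {u, v} ((\<lambda>a. {u, a}) ` A \<union> (\<lambda>b. {v, b}) ` B)"

text \<open>A double star described inside \<open>V\<close> by its centers and leaf sets, which
  avoids handling isomorphisms in the coloring arguments.\<close>

definition double_star_with :: "'a set \<Rightarrow> 'a set set \<Rightarrow> 'a \<Rightarrow> 'a \<Rightarrow> 'a set \<Rightarrow> 'a set \<Rightarrow> bool" where
  "double_star_with V E u v A B \<longleftrightarrow> u \<noteq> v \<and> {u, v} \<inter> (A \<union> B) = {} \<and> A \<inter> B = {} \<and>
     A \<noteq> {} \<and> B \<noteq> {} \<and> V = {u, v} \<union> A \<union> B \<and> E = star_pair u v A B"

lemma star_pair_image: "(`) f ` star_pair u v A B = star_pair (f u) (f v) (f ` A) (f ` B)"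
  by (simp add: star_pair_def image_Un image_image)

lemma star_pair_commute: "star_pair u v A B = star_pair v u B A"
  by (simp add: star_pair_def insert_commute Un_commute)

lemma double_star_with_commute: "double_star_with V E u v A B \<Longrightarrow> double_star_with V E v u B A"
  unfolding double_star_with_def star_pair_commute[of v u B A] by auto

lemma double_star_edges_eq: "double_star_edges m n = star_pair 0 1 {2..<m + 2} {m + 2..<m + n + 2}"
  by (auto simp: double_star_edges_def star_pair_def)

section \<open>Isomorphism with the standard double stars\<close>

text \<open>The inverse of the isomorphism serves as \<open>g\<close>. Since edges are two-element
  sets of vertices, equivalence on pairs becomes equality of edge sets.\<close>

lemma graph_iso_imp_image:
  assumes "graph_iso V E W F" "\<And>e. e \<in> E \<Longrightarrow> e \<subseteq> V \<and> card e = 2" "\<And>e. e \<in> F \<Longrightarrow> e \<subseteq> W \<and> card e = 2"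
  obtains g where "inj_on g W" "V = g ` W" "E = (`) g ` F"
proof -
  obtain f where f: "bij_betw f V W" and EF: "\<And>x y. x \<in> V \<Longrightarrow> y \<in> V \<Longrightarrow> {x, y} \<in> E \<longleftrightarrow> {f x, f y} \<in> F"
    using assms(1) unfolding graph_iso_def by blast
  define g where "g = inv_into V f"
  have g: "bij_betw g W V" unfolding g_def using f by (rule bij_betw_inv_into)
  have fg: "f (g w) = w" if "w \<in> W" for w
    unfolding g_def using f that by (simp add: bij_betw_inv_into_right)
  have gf: "g (f v) = v" if "v \<in> V" for v
    unfolding g_def using f that by (simp add: bij_betw_inv_into_left)
  have fV: "f v \<in> W" if "v \<in> V" for v using f that by (rule bij_betw_apply)
  have gW: "g v \<in> V" if "v \<in> W" for v using g that by (rule bij_betw_apply)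
  have "E = (`) g ` F"
  proof (intro equalityI subsetI)
    fix e assume e: "e \<in> E"
    then obtain x y where xy: "e = {x, y}" using assms(2) by (meson card_2_iff)
    then have "x \<in> V" "y \<in> V" using assms(2)[OF e] by auto
    then have "{f x, f y} \<in> F" "e = g ` {f x, f y}" using EF e by (auto simp: xy gf)
    then show "e \<in> (`) g ` F" by blast
  next
    fix e assume "e \<in> (`) g ` F"
    then obtain e' where e': "e' \<in> F" "e = g ` e'" by blast
    then obtain x y where xy: "e' = {x, y}" using assms(3) by (meson card_2_iff)
    then have "x \<in> W" "y \<in> W" using assms(3)[OF e'(1)] by auto
    then show "e \<in> E" using EF[of "g x" "g y"] e' by (simp add: xy fg gW)
  qed
  then show ?thesis using that[of g] g by (auto simp: bij_betw_def)
qed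

lemma star_pair_edges:
  assumes "u \<noteq> v" "{u, v} \<inter> (A \<union> B) = {}" "e \<in> star_pair u v A B"
  shows "e \<subseteq> {u, v} \<union> A \<union> B \<and> card e = 2"
  using assms by (auto simp: star_pair_def card_2_iff)

text \<open>The centers go to 0 and 1, and each leaf set is matched by cardinality with its interval
  of natural numbers.\<close>

lemma double_star_with_imp_is_double_star:
  assumes "finite V" "double_star_with V E u v A B"
  shows "is_double_star V E"
proof -
  have d: "u \<noteq> v" "{u, v} \<inter> (A \<union> B) = {}" "A \<inter> B = {}" "A \<noteq> {}" "B \<noteq> {}"
    "V = {u, v} \<union> A \<union> B" "E = star_pair u v A B"
    using assms(2) unfolding double_star_with_def by auto
  have fin: "finite A" "finite B" using assms(1) d by auto
  define m n where "m = card A" and "n = card B"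
  have mn: "m \<ge> 1" "n \<ge> 1" using fin d unfolding m_def n_def One_nat_def Suc_le_eq card_gt_0_iff by blast+
  obtain h where h: "bij_betw h A {2..<m + 2}"
    using finite_same_card_bij[OF fin(1), of "{2..<m + 2}"] unfolding m_def by force
  obtain k where k: "bij_betw k B {m + 2..<m + n + 2}"
    using finite_same_card_bij[OF fin(2), of "{m + 2..<m + n + 2}"] unfolding n_def by force
  define f where "f = (\<lambda>x. if x = u then 0 else if x = v then 1 else if x \<in> A then h x else k x)"
  have fA: "bij_betw f A {2..<m + 2}"
    using h by (rule iffD1[OF bij_betw_cong, rotated]) (use d in \<open>auto simp: f_def\<close>)
  have fB: "bij_betw f B {m + 2..<m + n + 2}"
    using k by (rule iffD1[OF bij_betw_cong, rotated]) (use d in \<open>auto simp: f_def\<close>)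
  have "bij_betw f {u, v} {0, 1}" using d by (auto simp: f_def bij_betw_def)
  then have "bij_betw f ({u, v} \<union> A) ({0, 1} \<union> {2..<m + 2})"
    by (rule bij_betw_combine[OF _ fA]) auto
  then have "bij_betw f ({u, v} \<union> A \<union> B) ({0, 1} \<union> {2..<m + 2} \<union> {m + 2..<m + n + 2})"
    by (rule bij_betw_combine[OF _ fB]) auto
  moreover have "{0, 1} \<union> {2..<m + 2} \<union> {m + 2..<m + n + 2} = double_star_verts m n"
    by (auto simp: double_star_verts_def)
  ultimately have f: "bij_betw f V (double_star_verts m n)" using d by simp
  have img: "(`) f ` E = double_star_edges m n"
  proof -
    have "f u = 0" "f v = 1" using d(1) by (simp_all add: f_def)
    then show ?thesis unfolding d(7) star_pair_image double_star_edges_eq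
      using fA fB by (simp add: bij_betw_def)
  qed
  \<comment> \<open>Taking images is injective on subsets of \<open>V\<close>, so membership in the
    image of \<open>E\<close> reflects membership in \<open>E\<close>.\<close>
  have "{x, y} \<in> E \<longleftrightarrow> {f x, f y} \<in> double_star_edges m n" if "x \<in> V" "y \<in> V" for x y
  proof -
    have "E \<subseteq> Pow V" using star_pair_edges[OF d(1,2)] d by blast
    moreover have "inj_on ((`) f) (Pow V)" using f by (auto intro: inj_on_image_Pow simp: bij_betw_def)
    moreover have "{f x, f y} = f ` {x, y}" by simp
    ultimately show ?thesis unfolding img[symmetric] using that
      by (metis Pow_iff empty_subsetI inj_on_image_mem_iff insert_subset)
  qed
  then show ?thesis
    unfolding is_double_star_def graph_iso_def using f mn by blast
qed

lemma is_double_star_imp_double_star_with: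
  assumes "fin_sgraph V E" "is_double_star V E"
  shows "\<exists>u v A B. double_star_with V E u v A B"
proof -
  obtain m n where mn: "m \<ge> 1" "n \<ge> 1"
    and iso: "graph_iso V E (double_star_verts m n) (double_star_edges m n)"
    using assms(2) unfolding is_double_star_def by blast
  let ?A = "{2..<m + 2}" and ?B = "{m + 2..<m + n + 2}"
  have W: "double_star_verts m n = {0, 1} \<union> ?A \<union> ?B"
    by (auto simp: double_star_verts_def)
  have E: "\<And>e. e \<in> E \<Longrightarrow> e \<subseteq> V \<and> card e = 2" using assms(1) unfolding fin_sgraph_def by blast
  have F: "e \<subseteq> double_star_verts m n \<and> card e = 2" if "e \<in> double_star_edges m n" for e
    using that unfolding double_star_edges_eq W by (intro star_pair_edges) auto
  obtain g where g: "inj_on g (double_star_verts m n)" "V = g ` double_star_verts m n"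
    "E = (`) g ` double_star_edges m n"
    by (rule graph_iso_imp_image[OF iso E F])
  have inj: "g x = g y \<longleftrightarrow> x = y" if "x < m + n + 2" "y < m + n + 2" for x y
    using inj_on_eq_iff[OF g(1), of x y] that by (simp add: double_star_verts_def)
  have "double_star_with V E (g 0) (g 1) (g ` ?A) (g ` ?B)"
    unfolding double_star_with_def g(2,3) double_star_edges_eq star_pair_image W
    using mn by (auto simp: inj)
  then show ?thesis by blast
qed

section \<open>Colorings of double stars and of their complements\<close>

lemma mem_complement_edges:
  "{x, y} \<in> complement_edges V E \<longleftrightarrow> x \<in> V \<and> y \<in> V \<and> x \<noteq> y \<and> {x, y} \<notin> E"
  by (auto simp: complement_edges_def card_2_iff doubleton_eq_iff)

lemma mem_star_pair:
  "{x, y} \<in> star_pair u v A B \<longleftrightarrow> {x, y} = {u, v} \<or> x = u \<and> y \<in> A \<or> y = u \<and> x \<in> A \<or>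
     x = v \<and> y \<in> B \<or> y = v \<and> x \<in> B"
  unfolding star_pair_def insert_iff Un_iff image_iff doubleton_eq_iff by blast

text \<open>In a tree the path between two leaves is unique: here \<open>a, u, a'\<close> or
  \<open>a, u, v, b\<close>. It has at most three edges, so all their colors differ.\<close>

lemma double_star_leaf_edges_neq:
  assumes ds: "double_star_with V E u v A B" and c: "proper_connecting_coloring V E c"
  shows "a \<in> A \<Longrightarrow> a' \<in> A \<Longrightarrow> a \<noteq> a' \<Longrightarrow> c {u, a} \<noteq> c {u, a'}"
    and "a \<in> A \<Longrightarrow> b \<in> B \<Longrightarrow>
      c {u, a} \<noteq> c {u, v} \<and> c {u, v} \<noteq> c {v, b} \<and> c {u, a} \<noteq> c {v, b}"
proof -
  have d: "u \<noteq> v" "u \<notin> A" "v \<notin> A" "u \<notin> B" "v \<notin> B" "A \<inter> B = {}"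
    "V = {u, v} \<union> A \<union> B" "E = star_pair u v A B"
    using ds unfolding double_star_with_def by auto
  have nbA: "y = u" if "{x, y} \<in> E" "x \<in> A" for x y
    using that d by (auto simp: mem_star_pair doubleton_eq_iff)
  have nbB: "y = v" if "{x, y} \<in> E" "x \<in> B" for x y
    using that d by (auto simp: mem_star_pair doubleton_eq_iff)
  have nbu: "y = v \<or> y \<in> A" if "{u, y} \<in> E" for y
    using that d by (auto simp: mem_star_pair doubleton_eq_iff)
  {
    fix a x assume a: "a \<in> A" and x: "x \<in> A \<union> B" "x \<noteq> a"
    then have "linked V E c a x"
      using c d unfolding proper_connecting_coloring_iff_linked by auto
    then obtain p where p: "p \<noteq> []" "distinct p" "hd p = a" "last p = x"
      and e: "\<And>i. Suc i < length p \<Longrightarrow> {p ! i, p ! Suc i} \<in> E"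
      and cp: "\<And>i j. i < j \<Longrightarrow> j \<le> i + 2 \<Longrightarrow> Suc j < length p \<Longrightarrow>
           c {p ! i, p ! Suc i} \<noteq> c {p ! j, p ! Suc j}"
      using linkedE by metis
    have "\<exists>q. p = a # u # q \<and> q \<noteq> []"
    proof -
      obtain q where q: "p = a # q" using p by (cases p) auto
      then have "q \<noteq> []" using p x by auto
      then obtain z r where zr: "q = z # r" by (cases q) auto
      then have "z = u" using e[of 0] nbA[of a z] a q by simp
      moreover have "r \<noteq> []" using p x d q zr \<open>z = u\<close> by auto
      ultimately show ?thesis using q zr by blast
    qed
    then obtain y r where yr: "p = a # u # y # r" by (metis neq_Nil_conv)
    have y: "y = v \<or> y \<in> A" using e[of 1] nbu yr by simp
    have c01: "c {a, u} \<noteq> c {u, y}" using cp[of 0 1] yr by simp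
    \<comment> \<open>A path cannot continue beyond a leaf in \<open>A\<close>: its only neighbor
      \<open>u\<close> has already been visited.\<close>
    have leaf: "r = []" if "y \<in> A"
    proof (rule ccontr)
      assume "r \<noteq> []"
      then obtain z s where "r = z # s" by (cases r) auto
      then have "z = u" using e[of 2] nbA[OF _ that, of z] yr by simp
      then show False using p yr \<open>r = z # s\<close> by simp
    qed
    have "c {a, u} \<noteq> c {u, x}" if "x \<in> A"
    proof (cases "y \<in> A")
      case True
      then show ?thesis using leaf yr p c01 by simp
    next
      case False
      then have "y = v" using y by simp
      \<comment> \<open>The vertex before the leaf \<open>x\<close> must be \<open>u\<close>, which
        already stands at position 1. This forces \<open>n = 1\<close>, so the path ends at its
        third vertex.\<close>
      obtain n where n: "length p = Suc (Suc n)" using yr by simp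
      then have "p ! Suc n = x" using p by (simp add: last_conv_nth)
      then have "p ! n = u"
        using e[of n] n nbA[of x "p ! n"] that by (simp add: insert_commute)
      moreover have "p ! 1 = u" using yr by simp
      ultimately have "n = 1" using nth_eq_iff_index_eq[OF p(2), of n 1] n yr by simp
      then have "r = []" using yr n by simp
      then show ?thesis using yr p c01 by simp
    qed
    moreover have "c {a, u} \<noteq> c {u, v} \<and> c {u, v} \<noteq> c {v, x} \<and> c {a, u} \<noteq> c {v, x}" if "x \<in> B"
    proof -
      have "y = v" using y leaf p yr that d by auto
      then have "r \<noteq> []" using p yr that d by auto
      then obtain z s where zs: "r = z # s" by (cases r) auto
      have "z \<noteq> u" using p yr zs by auto
      then have "z \<in> B" using e[of 2] yr zs \<open>y = v\<close> d
        by (auto simp: mem_star_pair doubleton_eq_iff)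
      have "s = []"
      proof (rule ccontr)
        assume "s \<noteq> []"
        then obtain w t where "s = w # t" by (cases s) auto
        then have "w = v" using e[of 3] nbB[OF _ \<open>z \<in> B\<close>, of w] yr zs by simp
        then show False using p yr zs \<open>y = v\<close> \<open>s = w # t\<close> by simp
      qed
      then have "p = [a, u, v, x]" using yr zs p \<open>y = v\<close> by simp
      then show ?thesis using cp[of 0 1] cp[of 0 2] cp[of 1 2] by simp
    qed
    ultimately have "(x \<in> A \<longrightarrow> c {a, u} \<noteq> c {u, x}) \<and>
      (x \<in> B \<longrightarrow> c {a, u} \<noteq> c {u, v} \<and> c {u, v} \<noteq> c {v, x} \<and> c {a, u} \<noteq> c {v, x})" by blast
  }
  note * = this
  show "a \<in> A \<Longrightarrow> a' \<in> A \<Longrightarrow> a \<noteq> a' \<Longrightarrow> c {u, a} \<noteq> c {u, a'}"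
    using *[of a a'] by (simp add: insert_commute[of a u])
  show "c {u, a} \<noteq> c {u, v} \<and> c {u, v} \<noteq> c {v, b} \<and> c {u, a} \<noteq> c {v, b}"
    if "a \<in> A" "b \<in> B"
  proof -
    have "b \<noteq> a" using that d(6) by blast
    then show ?thesis using *[of a b] that by (simp add: insert_commute[of a u])
  qed
qed

text \<open>Any two edges lie on a common path between leaves with at most three edges, so a valid
  coloring is injective on the \<open>card V - 1\<close> edges.\<close>

lemma pc12_double_star:
  assumes "finite V" "connected_graph V E" and ds: "double_star_with V E u v A B"
  shows "pc12 V E + 1 = card V"
proof -
  have d: "u \<noteq> v" "u \<notin> A" "v \<notin> A" "u \<notin> B" "v \<notin> B" "A \<inter> B = {}" "A \<noteq> {}" "B \<noteq> {}"
    "V = {u, v} \<union> A \<union> B" "E = star_pair u v A B"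
    using ds unfolding double_star_with_def by auto
  have fin: "finite A" "finite B" using assms(1) d by auto
  have cV: "card V = 2 + card A + card B"
    using d fin by (simp add: card_Un_disjoint Int_Un_distrib)
  obtain c0 :: "'a set \<Rightarrow> nat" where c0: "proper_connecting_coloring V E c0" "card (c0 ` E) + 1 \<le> card V"
    using proper_connecting_coloring_exists[OF assms(1,2)] cV by auto
  have "card V - 1 \<le> card (c ` E)" if c: "proper_connecting_coloring V E c" for c :: "'a set \<Rightarrow> nat"
  proof -
    note neq = double_star_leaf_edges_neq[OF ds c]
    note neq' = double_star_leaf_edges_neq[OF double_star_with_commute[OF ds] c]
    \<comment> \<open>These leaves complete a path through \<open>{u, v}\<close> when only one leaf
      edge is prescribed.\<close>
    obtain a0 b0 where ab0: "a0 \<in> A" "b0 \<in> B" using d by blast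
    have iA: "inj_on (\<lambda>a. c {u, a}) A" using neq(1) by (auto simp: inj_on_def)
    have iB: "inj_on (\<lambda>b. c {v, b}) B" using neq'(1) by (auto simp: inj_on_def)
    let ?X = "(\<lambda>a. c {u, a}) ` A" and ?Y = "(\<lambda>b. c {v, b}) ` B"
    have dis: "?X \<inter> ?Y = {}" "c {u, v} \<notin> ?X \<union> ?Y"
    proof -
      show "?X \<inter> ?Y = {}" using neq(2) by blast
      have "c {u, v} \<noteq> c {u, a}" if "a \<in> A" for a using neq(2)[OF that ab0(2)] by simp
      moreover have "c {u, v} \<noteq> c {v, b}" if "b \<in> B" for b using neq(2)[OF ab0(1) that] by simp
      ultimately show "c {u, v} \<notin> ?X \<union> ?Y" by blast
    qed
    have "c ` E = insert (c {u, v}) (?X \<union> ?Y)"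
      by (simp add: d star_pair_def image_Un image_image)
    then have "card (c ` E) = Suc (card A + card B)"
      using dis fin by (simp add: card_Un_disjoint card_image[OF iA] card_image[OF iB])
    then show ?thesis using cV by simp
  qed
  then have "card V - 1 \<le> pc12 V E" by (rule pc12_ge[OF c0(1)])
  moreover have "pc12 V E \<le> card V - 1" by (rule pc12_le[OF c0(1)]) (use c0 in simp)
  ultimately show ?thesis using cV by simp
qed

lemma card_image_le_if_range3: "range c \<subseteq> {0, 1, 2 :: nat} \<Longrightarrow> card (c ` E) \<le> 3"
proof -
  assume "range c \<subseteq> {0, 1, 2 :: nat}"
  then have "c ` E \<subseteq> {0, 1, 2}" by (meson image_mono subset_UNIV order_trans)
  then have "card (c ` E) \<le> card {0, 1, 2 :: nat}" by (intro card_mono) auto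
  then show ?thesis by simp
qed

text \<open>In the complement the leaves form a clique, \<open>u\<close> is joined exactly to
  \<open>B\<close> and \<open>v\<close> exactly to \<open>A\<close>. Arcs \<open>u\<close> to
  \<open>B\<close> to \<open>A\<close> to \<open>v\<close> connect all nonadjacent pairs, and
  \<open>u\<close> and \<open>v\<close> themselves force three colors.\<close>

lemma pc12_complement_double_star:
  assumes "finite V" and ds: "double_star_with V E u v A B"
  shows "pc12 V (complement_edges V E) = 3"
proof -
  let ?H = "complement_edges V E"
  have d: "u \<noteq> v" "u \<notin> A" "v \<notin> A" "u \<notin> B" "v \<notin> B" "A \<inter> B = {}" "A \<noteq> {}" "B \<noteq> {}"
    "V = {u, v} \<union> A \<union> B" "E = star_pair u v A B"
    using ds unfolding double_star_with_def by auto
  have H: "{x, y} \<in> ?H \<longleftrightarrow> x \<noteq> y \<and> (x \<in> A \<union> B \<and> y \<in> A \<union> B \<or> x = u \<and> y \<in> B \<or> y = u \<and> x \<in> B \<or>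
      x = v \<and> y \<in> A \<or> y = v \<and> x \<in> A)" for x y
    unfolding mem_complement_edges d(9,10) mem_star_pair using d(1-6) by (auto simp: doubleton_eq_iff)
  \<comment> \<open>Both centers get the label 0: \<open>u\<close> before the label 1 of
    \<open>B\<close>, and \<open>v\<close> after the label 2 of \<open>A\<close>.\<close>
  define lab :: "'a \<Rightarrow> nat" where "lab = (\<lambda>x. if x \<in> B then 1 else if x \<in> A then 2 else 0)"
  define D where "D = {u} \<times> B \<union> B \<times> A \<union> A \<times> {v}"
  obtain a0 b0 where ab0: "a0 \<in> A" "b0 \<in> B" using d by blast
  have step: "(u, b) \<in> D\<^sup>*" "(b, a) \<in> D\<^sup>*" "(a, v) \<in> D\<^sup>*" if "a \<in> A" "b \<in> B" for a b
    using that by (auto simp: D_def intro: r_into_rtrancl)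
  have reach: "(u, v) \<in> D\<^sup>*" "(u, a) \<in> D\<^sup>*" "(b, v) \<in> D\<^sup>*" if "a \<in> A" "b \<in> B" for a b
    using step[OF that] step[OF that(1) ab0(2)] step[OF ab0(1) that(2)]
    by (meson rtrancl_trans)+
  have "\<exists>c :: 'a set \<Rightarrow> nat. proper_connecting_coloring V ?H c \<and> range c \<subseteq> {0, 1, 2}"
  proof (rule increasing_coloring[where A = D and B = "{}" and lab = lab])
    show "{x, y} \<in> ?H \<and> x \<in> V \<and> y \<in> V \<and> lab y mod 3 = Suc (lab x) mod 3" if "(x, y) \<in> D" for x y
    proof -
      consider "x = u" "y \<in> B" | "x \<in> B" "y \<in> A" | "x \<in> A" "y = v"
        using \<open>(x, y) \<in> D\<close> unfolding D_def by blast
      then show ?thesis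
      proof cases
        case 1
        then show ?thesis using d(1-6) H[of x y] by (auto simp: lab_def d(9))
      next
        case 2
        then have "x \<noteq> y" "y \<notin> B" using d(6) by auto
        then show ?thesis using 2 H[of x y] by (simp add: lab_def d(9))
      next
        case 3
        then have "x \<noteq> y" "x \<notin> B" using d(1-6) by auto
        then show ?thesis using 3 d(1-6) H[of x y] by (simp add: lab_def d(9))
      qed
    qed
    show "{x, y} \<in> ?H \<or> (x, y) \<in> D\<^sup>* O {}\<^sup>= \<or> (y, x) \<in> D\<^sup>* O {}\<^sup>="
      if "x \<in> V" "y \<in> V" "x \<noteq> y" for x y
    proof -
      have "{x, y} \<in> ?H \<or> (x, y) \<in> D\<^sup>* \<or> (y, x) \<in> D\<^sup>*"
      proof -
        have r: "s \<in> {u} \<and> t = v \<Longrightarrow> (s, t) \<in> D\<^sup>*" "s = u \<and> t \<in> A \<Longrightarrow> (s, t) \<in> D\<^sup>*"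
          "s \<in> B \<and> t = v \<Longrightarrow> (s, t) \<in> D\<^sup>*" for s t
          using reach ab0 by auto
        have "x = u \<or> x = v \<or> x \<in> A \<or> x \<in> B" "y = u \<or> y = v \<or> y \<in> A \<or> y \<in> B"
          using that(1,2) d(9) by auto
        then show ?thesis
          using that(3) H[of x y] r[of x y] r[of y x] by auto
      qed
      then show ?thesis by simp
    qed
  qed auto
  then obtain c :: "'a set \<Rightarrow> nat" where c: "proper_connecting_coloring V ?H c" "range c \<subseteq> {0, 1, 2}"
    by blast
  \<comment> \<open>Neighbors of \<open>u\<close> lie in \<open>B\<close> and none of them is
    adjacent to \<open>v\<close>, so a path from \<open>u\<close> to \<open>v\<close> has at least
    three edges; the first three have different colors.\<close>
  have "3 \<le> card (c ` ?H)" if c: "proper_connecting_coloring V ?H c" for c :: "'a set \<Rightarrow> nat"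
  proof -
    have "linked V ?H c u v" using c d unfolding proper_connecting_coloring_iff_linked by auto
    then obtain p where p: "p \<noteq> []" "hd p = u" "last p = v"
      and e: "\<And>i. Suc i < length p \<Longrightarrow> {p ! i, p ! Suc i} \<in> ?H"
      and cp: "\<And>i j. i < j \<Longrightarrow> j \<le> i + 2 \<Longrightarrow> Suc j < length p \<Longrightarrow>
           c {p ! i, p ! Suc i} \<noteq> c {p ! j, p ! Suc j}"
      using linkedE by metis
    obtain q where q: "p = u # q" using p by (cases p) auto
    then obtain x r where xr: "q = x # r" using p d by (cases q) auto
    then have x: "x \<in> B" using e[of 0] q H[of u x] d by auto
    then obtain y s where ys: "r = y # s" using p d xr q by (cases r) auto
    have "y \<noteq> v" using e[of 1] q xr ys H[of x y] d x by auto
    then obtain z t where "s = z # t" using p d xr q ys by (cases s) auto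
    then have p: "p = u # x # y # z # t" using q xr ys by simp
    have "c {u, x} \<noteq> c {x, y}" "c {u, x} \<noteq> c {y, z}" "c {x, y} \<noteq> c {y, z}"
      using cp[of 0 1] cp[of 0 2] cp[of 1 2] p by auto
    then have "card {c {u, x}, c {x, y}, c {y, z}} = 3" by simp
    moreover have "{c {u, x}, c {x, y}, c {y, z}} \<subseteq> c ` ?H"
      using e[of 0] e[of 1] e[of 2] p by auto
    moreover have "finite (c ` ?H)"
      by (rule finite_imageI, rule finite_subset[of _ "Pow V"])
        (use assms(1) in \<open>auto simp: complement_edges_def\<close>)
    ultimately show ?thesis by (metis card_mono)
  qed
  then have "3 \<le> pc12 V ?H" by (rule pc12_ge[OF c(1)])
  moreover have "pc12 V ?H \<le> 3"
    by (rule pc12_le[OF c(1)]) (rule card_image_le_if_range3[OF c(2)])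
  ultimately show ?thesis by simp
qed

section \<open>Graphs without a path on five vertices\<close>

text \<open>A path \<open>a, b, c, d\<close> is found first. Every other vertex must then be a leaf
  at exactly one of \<open>b\<close> and \<open>c\<close>, since anything else produces five
  vertices on a path or disconnects \<open>E\<close> or its complement.\<close>

lemma double_star_if_no_path5:
  assumes fg: "fin_sgraph V E" and V2: "card V \<ge> 2"
    and conn: "connected_graph V E" and conn': "connected_graph V (complement_edges V E)"
    and no: "\<not> has_path5 V E"
  shows "\<exists>u v A B. double_star_with V E u v A B"
proof -
  define N where "N x y \<longleftrightarrow> {x, y} \<in> E" for x y
  have eV: "e \<subseteq> V \<and> card e = 2" if "e \<in> E" for e using fg that unfolding fin_sgraph_def by blast
  have Nc: "N y x" if "N x y" for x y using that unfolding N_def by (simp add: insert_commute)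
  have NV: "x \<in> V \<and> y \<in> V \<and> x \<noteq> y" if "N x y" for x y
    using eV[of "{x, y}"] that unfolding N_def by (auto simp: card_2_iff')
  have P5: False if "N a b" "N b c" "N c d" "N d e" "distinct [a, b, c, d, e]" for a b c d e
    using no that NV[OF that(1)] NV[OF that(2)] NV[OF that(3)] NV[OF that(4)]
    unfolding has_path5_def N_def by blast
  have bd: "\<exists>p\<in>U. \<exists>w\<in>V - U. N p w" if "U \<subseteq> V" "U \<noteq> {}" "U \<noteq> V" for U
    using connected_boundary_edge[OF conn that] unfolding N_def by blast
  have bd': "\<exists>p\<in>U. \<exists>w\<in>V - U. \<not> N p w" if "U \<subseteq> V" "U \<noteq> {}" "U \<noteq> V" for U
    using connected_boundary_edge[OF conn' that] unfolding N_def mem_complement_edges by blast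
  \<comment> \<open>A vertex adjacent to all others would be isolated in the complement.\<close>
  have nonuniv: "\<exists>w\<in>V. w \<noteq> x \<and> \<not> N x w" if "x \<in> V" for x
  proof -
    have "{x} \<noteq> V" using V2 by auto
    then show ?thesis using bd'[of "{x}"] that by auto
  qed
  \<comment> \<open>A first edge \<open>{x, y}\<close> does not exhaust \<open>V\<close>, because
    \<open>x\<close> has a non-neighbor; an edge leaving \<open>{x, y}\<close> then gives a vertex
    with two neighbors.\<close>
  obtain b c0 c1 where b: "N b c0" "N b c1" "c0 \<noteq> c1"
  proof -
    obtain x where x: "x \<in> V" using conn unfolding connected_graph_def by blast
    have "{x} \<noteq> V" using V2 by auto
    then obtain y where y: "N x y" using bd[of "{x}"] x by auto
    have "{x, y} \<noteq> V" using nonuniv[OF x] y by auto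
    then obtain p w where "p \<in> {x, y}" "w \<notin> {x, y}" "N p w"
      using bd[of "{x, y}"] NV[OF y] by auto
    then show ?thesis using that[of x y w] that[of y x w] y Nc[OF y] by auto
  qed
  \<comment> \<open>An edge leaving the closed neighborhood of \<open>b\<close> starts at a neighbor
    of \<open>b\<close> and ends at distance two from \<open>b\<close>.\<close>
  obtain c d where cd: "N b c" "N c d" "\<not> N b d" "d \<noteq> b"
  proof -
    let ?S = "insert b {x. N b x}"
    have "?S \<subseteq> V" using NV b by blast
    moreover have "?S \<noteq> V" using nonuniv[of b] NV[OF b(1)] by blast
    ultimately obtain p w where "p \<in> ?S" "w \<in> V - ?S" "N p w" using bd[of ?S] by blast
    then show ?thesis using that by blast
  qed
  obtain a where a: "N b a" "a \<noteq> c" using b by metis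
  have dist: "a \<noteq> b" "a \<noteq> c" "a \<noteq> d" "b \<noteq> c" "b \<noteq> d" "c \<noteq> d"
    using a cd NV by blast+
  have inV: "a \<in> V" "b \<in> V" "c \<in> V" "d \<in> V" using a cd NV by blast+
  have path: "N a b" "N b c" "N c d" "N d c" "N c b" "N b a" using a cd Nc by auto
  define R where "R = V - {a, b, c, d}"
  have R: "w \<noteq> a" "w \<noteq> b" "w \<noteq> c" "w \<noteq> d" "w \<in> V" if "w \<in> R" for w
    using that unfolding R_def by auto
  \<comment> \<open>Otherwise \<open>w\<close> would prolong the path \<open>a, b, c, d\<close> at
    its end.\<close>
  have aR: "\<not> N a w" "\<not> N w a" if "w \<in> R" for w
    using P5[of w a b c d] path dist R[OF that] Nc[of a w] by auto
  have dR: "\<not> N d w" "\<not> N w d" if "w \<in> R" for w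
    using P5[of a b c d w] path dist R[OF that] Nc[of w d] by auto
  have RR: "\<not> N w w'" if "w \<in> R" "w' \<in> R" "N b w \<or> N c w" for w w'
  proof
    assume n: "N w w'"
    have "w \<noteq> w'" using NV[OF n] by simp
    then show False
      using P5[of w' w b c d] P5[of w' w c b a] path dist R[OF that(1)] R[OF that(2)] that(3)
        Nc[OF n] Nc[of b w] Nc[of c w] by auto
  qed
  \<comment> \<open>If some vertex of \<open>R\<close> had neither neighbor, no edge could leave
    \<open>?S\<close>: by \<open>aR\<close>, \<open>dR\<close> and \<open>RR\<close>, such an edge
    would have to start at \<open>b\<close> or \<open>c\<close>, and its end would lie in
    \<open>?S\<close>.\<close>
  have cover: "N b w \<or> N c w" if "w \<in> R" for w
  proof (rule ccontr)
    assume n: "\<not> (N b w \<or> N c w)"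
    let ?S = "{a, b, c, d} \<union> {w \<in> R. N b w \<or> N c w}"
    have "?S \<subseteq> V" using inV R by blast
    moreover have "?S \<noteq> V" using n that R[OF that] by blast
    ultimately obtain p w' where p: "p \<in> ?S" "w' \<in> V - ?S" "N p w'" using bd[of ?S] by blast
    then have w': "w' \<in> R" "\<not> N b w'" "\<not> N c w'" by (auto simp: R_def)
    then show False using p(1,3) aR(1) dR(1) RR by auto
  qed
  have notboth: "\<not> (N b w \<and> N c w)" if "w \<in> R" for w
    using P5[of a b w c d] path dist R[OF that] Nc[of c w] by auto
  \<comment> \<open>Some \<open>y\<close> is not adjacent to \<open>c\<close>; by
    \<open>cover\<close> it is a neighbor of \<open>b\<close>, and \<open>y, b, a, c, d\<close> is a
    forbidden path.\<close>
  have nac: "\<not> N a c"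
  proof
    assume n: "N a c"
    obtain y where y: "y \<in> V" "y \<noteq> c" "\<not> N c y" using nonuniv[OF inV(3)] by blast
    then have yR: "y \<in> R" using path Nc[OF n] by (auto simp: R_def)
    then have "N b y" using cover y by blast
    then show False using P5[of y b a c d] path dist R[OF yR] n Nc[of b y] by auto
  qed
  \<comment> \<open>The edge would close a 4-cycle. A further vertex extends it to a five-vertex
    path, and with no further vertex \<open>{b, d}\<close> is separated in the complement.\<close>
  have nad: "\<not> N a d"
  proof
    assume n: "N a d"
    have "R = {}"
    proof (rule ccontr)
      assume "R \<noteq> {}"
      then obtain w where w: "w \<in> R" by blast
      then show False using cover[OF w] P5[of w b a d c] P5[of w c d a b]
          path dist R[OF w] n Nc[of b w] Nc[of c w] Nc[OF n] by auto
    qed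
    then have V4: "V = {a, b, c, d}" using inV by (auto simp: R_def)
    have "{b, d} \<noteq> V" using V4 dist by auto
    then obtain p w where "p \<in> {b, d}" "w \<in> V - {b, d}" "\<not> N p w" using bd'[of "{b, d}"] inV by blast
    then show False using V4 path n Nc[OF n] by auto
  qed
  have irr: "\<not> N x x" for x using NV by blast
  define A where "A = insert a {w \<in> R. N b w}"
  define B where "B = insert d {w \<in> R. N c w}"
  have "b \<notin> R" "c \<notin> R" "a \<notin> R" "d \<notin> R" by (simp_all add: R_def)
  then have AB: "{b, c} \<inter> (A \<union> B) = {}" "A \<inter> B = {}" "A \<noteq> {}" "B \<noteq> {}"
    using dist notboth unfolding A_def B_def by blast+
  have "V = {a, b, c, d} \<union> R" using inV unfolding R_def by blast
  then have V: "V = {b, c} \<union> A \<union> B" using cover unfolding A_def B_def by blast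
  have AB_cases: "x = a \<or> x = d \<or> x \<in> R" if "x \<in> A \<union> B" for x
    using that unfolding A_def B_def by blast
  have indep: "\<not> N x y" if "x \<in> A \<union> B" "y \<in> A \<union> B" for x y
  proof (cases "x \<in> R \<or> y \<in> R")
    case True
    then show ?thesis using AB_cases[OF that(1)] AB_cases[OF that(2)] aR dR RR cover by metis
  next
    case False
    then show ?thesis using AB_cases[OF that(1)] AB_cases[OF that(2)] nad irr Nc[of d a] by metis
  qed
  have bA: "N b x" if "x \<in> A" for x using that path unfolding A_def by auto
  have cB: "N c x" if "x \<in> B" for x using that path unfolding B_def by auto
  have bB: "\<not> N b x" if "x \<in> B" for x using that cd notboth unfolding B_def by auto
  have cA: "\<not> N c x" if "x \<in> A" for x using that nac Nc[of c a] notboth unfolding A_def by auto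
  have "E = star_pair b c A B"
  proof (intro equalityI subsetI)
    fix e assume e: "e \<in> E"
    then obtain x y where xy: "e = {x, y}" using eV by (meson card_2_iff)
    then have n: "N x y" using e by (simp add: N_def)
    have "x \<in> {b, c} \<union> A \<union> B" "y \<in> {b, c} \<union> A \<union> B" "x \<noteq> y" using NV[OF n] V by auto
    then show "e \<in> star_pair b c A B"
      unfolding xy mem_star_pair doubleton_eq_iff using n Nc[OF n] indep[of x y] bB cA by auto
  next
    fix e assume "e \<in> star_pair b c A B"
    then show "e \<in> E" using path bA cB unfolding star_pair_def N_def by auto
  qed
  then show ?thesis unfolding double_star_with_def using AB V dist by blast
qed

section \<open>Strongly connected labelings\<close>

text \<open>Labels matter only modulo 3, so a predecessor label can be written by adding 2.\<close>

definition label_arcs :: "'a set set \<Rightarrow> 'a set \<Rightarrow> ('a \<Rightarrow> nat) \<Rightarrow> ('a \<times> 'a) set" where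
  "label_arcs E K lab = {(a, b). a \<in> K \<and> b \<in> K \<and> {a, b} \<in> E \<and> lab b mod 3 = Suc (lab a) mod 3}"

definition core :: "'a set set \<Rightarrow> 'a set \<Rightarrow> ('a \<Rightarrow> nat) \<Rightarrow> bool" where
  "core E K lab \<longleftrightarrow> (\<forall>a\<in>K. \<forall>b\<in>K. (a, b) \<in> (label_arcs E K lab)\<^sup>*)"

lemma coreI_root:
  assumes "\<And>a. a \<in> K \<Longrightarrow> (r, a) \<in> (label_arcs E K lab)\<^sup>*"
    and "\<And>a. a \<in> K \<Longrightarrow> (a, r) \<in> (label_arcs E K lab)\<^sup>*"
  shows "core E K lab"
  unfolding core_def using assms by (meson rtrancl_trans)

text \<open>The new vertex closes a directed triangle of labels: its label follows that of
  \<open>q\<close>, and modulo 3 the label of \<open>p\<close> follows its own. So it is entered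
  from \<open>q\<close> and left to \<open>p\<close>.\<close>

lemma core_insert_aux:
  assumes "core E K lab" "p \<in> K" "q \<in> K" "w \<notin> K" "{p, w} \<in> E" "{q, w} \<in> E"
    and lab: "lab q mod 3 = Suc (lab p) mod 3"
  shows "core E (insert w K) (lab(w := Suc (lab q)))"
proof -
  let ?lab = "lab(w := Suc (lab q))"
  let ?D = "label_arcs E (insert w K) ?lab"
  have "label_arcs E K lab \<subseteq> ?D"
    using assms(4) by (auto simp: label_arcs_def)
  then have old: "(a, b) \<in> ?D\<^sup>*" if "a \<in> K" "b \<in> K" for a b
    using assms(1) that unfolding core_def by (meson rtrancl_mono subsetD)
  have "lab p mod 3 = Suc (Suc (lab q)) mod 3"
    using lab by presburger
  then have "(q, w) \<in> ?D" "(w, p) \<in> ?D"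
    using assms by (auto simp: label_arcs_def insert_commute)
  then have "(p, w) \<in> ?D\<^sup>*" "(w, p) \<in> ?D\<^sup>*"
    using old[OF assms(2,3)] by (auto intro: rtrancl_into_rtrancl)
  then show ?thesis
    using old assms(2) by (intro coreI_root[of _ p]) auto
qed

lemma mod3_neq_cases:
  fixes a b :: nat
  assumes "a mod 3 \<noteq> b mod 3"
  shows "b mod 3 = Suc a mod 3 \<or> a mod 3 = Suc b mod 3"
proof -
  have "a mod 3 < 3" "b mod 3 < 3" by simp_all
  then show ?thesis using assms by (auto simp: mod_Suc)
qed

text \<open>Two different residues modulo 3 are consecutive in one of the two orders. In a largest
  core this forbids an outside vertex with neighbors of different labels.\<close>

lemma core_insert:
  assumes "core E K lab" "p \<in> K" "q \<in> K" "w \<notin> K" "{p, w} \<in> E" "{q, w} \<in> E"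
    and "lab p mod 3 \<noteq> lab q mod 3"
  shows "\<exists>lab'. core E (insert w K) lab'"
proof -
  have "lab q mod 3 = Suc (lab p) mod 3 \<or> lab p mod 3 = Suc (lab q) mod 3"
    using assms(7) by (rule mod3_neq_cases)
  then show ?thesis
    using core_insert_aux[OF assms(1-6)] core_insert_aux[OF assms(1,3,2,4,6,5)] by blast
qed

text \<open>The directed triangles \<open>x, y, t\<close> all share the arc from \<open>x\<close> to
  \<open>y\<close>, so their union is strongly connected whatever the edges inside
  \<open>T\<close>.\<close>

lemma core_triangle:
  assumes "{x, y} \<in> E" "x \<noteq> y" "T \<noteq> {}" "x \<notin> T" "y \<notin> T"
    and "\<And>t. t \<in> T \<Longrightarrow> {x, t} \<in> E \<and> {y, t} \<in> E"
  shows "core E ({x, y} \<union> T) ((\<lambda>_. 2)(x := 0, y := 1))"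
proof -
  let ?D = "label_arcs E ({x, y} \<union> T) ((\<lambda>_. 2)(x := 0, y := 1))"
  have lab: "((\<lambda>_. 2 :: nat)(x := 0, y := 1)) t = 2" if "t \<in> T" for t
    using that assms(4,5) by auto
  have xy: "(x, y) \<in> ?D" using assms(1,2) by (simp add: label_arcs_def)
  have yt: "(y, t) \<in> ?D" and tx: "(t, x) \<in> ?D" if "t \<in> T" for t
    using assms(2) assms(6)[OF that] that lab[OF that] by (auto simp: label_arcs_def insert_commute)
  obtain t where t: "t \<in> T" using assms(3) by blast
  have "(y, x) \<in> ?D\<^sup>*" using yt[OF t] tx[OF t] by (meson rtrancl.simps)
  moreover have "(x, y) \<in> ?D\<^sup>*" using xy by blast
  ultimately show ?thesis
    using xy yt tx by (intro coreI_root[of _ x]) (auto intro: rtrancl_into_rtrancl)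
qed

text \<open>The hexagons \<open>a, b, c, d, e, t\<close> share the path from \<open>a\<close> to
  \<open>e\<close> and are directed by the labels 0, 1, 2, 0, 1, 2.\<close>

lemma core_hexagon:
  assumes "{a, b} \<in> E" "{b, c} \<in> E" "{c, d} \<in> E" "{d, e} \<in> E"
    and dist: "distinct [a, b, c, d, e]" and T: "T \<noteq> {}" "{a, b, c, d, e} \<inter> T = {}"
    and "\<And>t. t \<in> T \<Longrightarrow> {e, t} \<in> E \<and> {a, t} \<in> E"
  shows "\<exists>lab. core E ({a, b, c, d, e} \<union> T) lab"
proof -
  \<comment> \<open>The default 2 covers \<open>c\<close> and all of \<open>T\<close>.\<close>
  define lab :: "'a \<Rightarrow> nat" where "lab = (\<lambda>_. 2)(a := 0, b := 1, d := 0, e := 1)"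
  let ?K = "{a, b, c, d, e} \<union> T"
  let ?D = "label_arcs E ?K lab"
  have l: "lab a = 0" "lab b = 1" "lab c = 2" "lab d = 0" "lab e = 1"
    using dist by (auto simp: lab_def)
  have lT: "lab t = 2" if "t \<in> T" for t using T(2) that by (auto simp: lab_def)
  have ab: "(a, b) \<in> ?D" and bc: "(b, c) \<in> ?D" and cd: "(c, d) \<in> ?D" and de: "(d, e) \<in> ?D"
    using assms(1-4) l by (simp_all add: label_arcs_def)
  have eT: "(e, t) \<in> ?D" and Ta: "(t, a) \<in> ?D" if "t \<in> T" for t
    using assms(8)[OF that] that l lT[OF that] by (auto simp: label_arcs_def insert_commute)
  obtain t where t: "t \<in> T" using T by blast
  have A: "(a, b) \<in> ?D\<^sup>*" using ab by blast
  have B: "(a, c) \<in> ?D\<^sup>*" using A bc by (rule rtrancl_into_rtrancl)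
  have C: "(a, d) \<in> ?D\<^sup>*" using B cd by (rule rtrancl_into_rtrancl)
  have D: "(a, e) \<in> ?D\<^sup>*" using C de by (rule rtrancl_into_rtrancl)
  have F: "(a, s) \<in> ?D\<^sup>*" if "s \<in> T" for s using D eT[OF that] by (rule rtrancl_into_rtrancl)
  have F': "(s, a) \<in> ?D\<^sup>*" if "s \<in> T" for s using Ta[OF that] by blast
  have D': "(e, a) \<in> ?D\<^sup>*" using eT[OF t] F'[OF t] by (rule converse_rtrancl_into_rtrancl)
  have C': "(d, a) \<in> ?D\<^sup>*" using de D' by (rule converse_rtrancl_into_rtrancl)
  have B': "(c, a) \<in> ?D\<^sup>*" using cd C' by (rule converse_rtrancl_into_rtrancl)
  have A': "(b, a) \<in> ?D\<^sup>*" using bc B' by (rule converse_rtrancl_into_rtrancl)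
  have "core E ?K lab"
  proof (rule coreI_root[of _ a])
    fix k assume "k \<in> ?K"
    then consider "k = a" | "k = b" | "k = c" | "k = d" | "k = e" | "k \<in> T" by blast
    then show "(a, k) \<in> ?D\<^sup>*" "(k, a) \<in> ?D\<^sup>*"
      by (cases; use A B C D F A' B' C' D' F' in simp)+
  qed
  then show ?thesis by blast
qed

section \<open>Coloring a graph around a core\<close>

text \<open>
  A vertex of \<open>W\<close> is left through one of its neighbors in \<open>K\<close> and entered through the other.
  The vertices of \<open>X\<close> are only left, via one attached vertex, and those of \<open>Y\<close> are only
  entered; two vertices of the same kind are adjacent.
\<close>

lemma core_coloring:
  assumes core: "core E K lab" "K \<subseteq> V" "K \<noteq> {}"
    and W: "\<And>w. w \<in> W \<Longrightarrow> \<exists>p\<in>K. \<exists>q\<in>K. p \<noteq> q \<and> {w, p} \<in> E \<and> {w, q} \<in> E"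
    and X: "\<And>x x'. x \<in> X \<Longrightarrow> x' \<in> X \<Longrightarrow> x \<noteq> x' \<Longrightarrow> {x, x'} \<in> E"
    and X_att: "X \<noteq> {} \<Longrightarrow> \<exists>x\<in>X. \<exists>r\<in>K \<union> W. {x, r} \<in> E"
    and Y: "\<And>y y'. y \<in> Y \<Longrightarrow> y' \<in> Y \<Longrightarrow> y \<noteq> y' \<Longrightarrow> {y, y'} \<in> E"
    and Y_att: "\<And>y. y \<in> Y \<Longrightarrow> \<exists>k\<in>K. {y, k} \<in> E"
    and V: "V = K \<union> W \<union> X \<union> Y"
    and dis: "K \<inter> W = {}" "K \<inter> X = {}" "K \<inter> Y = {}" "W \<inter> X = {}" "W \<inter> Y = {}" "X \<inter> Y = {}"
  shows "\<exists>c :: 'a set \<Rightarrow> nat. proper_connecting_coloring V E c \<and> range c \<subseteq> {0, 1, 2}"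
proof -
  have "\<forall>w. \<exists>p q. w \<in> W \<longrightarrow> p \<in> K \<and> q \<in> K \<and> p \<noteq> q \<and> {w, p} \<in> E \<and> {w, q} \<in> E"
    using W by blast
  then obtain out inW where oi: "\<And>w. w \<in> W \<Longrightarrow> out w \<in> K \<and> inW w \<in> K \<and> out w \<noteq> inW w \<and>
      {w, out w} \<in> E \<and> {w, inW w} \<in> E" by metis
  have "\<forall>y. \<exists>k. y \<in> Y \<longrightarrow> k \<in> K \<and> {y, k} \<in> E"
    using Y_att by blast
  then obtain inY where iY: "\<And>y. y \<in> Y \<Longrightarrow> inY y \<in> K \<and> {y, inY y} \<in> E" by metis
  define i where "i = (\<lambda>v. if v \<in> W then inW v else inY v)"
  have i: "i v \<in> K \<and> {i v, v} \<in> E" if "v \<in> W \<union> Y" for v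
    using that oi iY by (auto simp: i_def insert_commute)
  have iW: "i w \<noteq> out w" if "w \<in> W" for w using oi[OF that] that by (auto simp: i_def)
  obtain x0 r where x0: "X \<noteq> {} \<Longrightarrow> x0 \<in> X \<and> r \<in> K \<union> W \<and> {x0, r} \<in> E"
    using X_att by blast
  \<comment> \<open>Adding 2 means one less modulo 3: \<open>w\<close> precedes
    \<open>out w\<close>, \<open>x0\<close> precedes \<open>r\<close>, and every other vertex of
    \<open>X\<close> precedes \<open>x0\<close>, which explains the 4.\<close>
  define l1 where "l1 = (\<lambda>v. if v \<in> W then lab (out v) + 2 else lab v)"
  define l where "l = (\<lambda>v. if v \<in> X then (if v = x0 then l1 r + 2 else l1 r + 4) else l1 v)"
  have lK: "l v = lab v" if "v \<in> K" for v using that dis by (auto simp: l_def l1_def)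
  have lW: "l v = lab (out v) + 2" if "v \<in> W" for v using that dis by (auto simp: l_def l1_def)
  have lr: "l r = l1 r" if "X \<noteq> {}" using x0[OF that] dis by (auto simp: l_def)
  define A1 where "A1 = label_arcs E K lab"
  define A2 where "A2 = {(w, out w) |w. w \<in> W}"
  define A3 where "A3 = {(x, r) |x. x \<in> X \<and> x = x0}"
  define A4 where "A4 = {(x, x0) |x. x \<in> X \<and> x \<noteq> x0}"
  define A where "A = A1 \<union> A2 \<union> A3 \<union> A4"
  define B where "B = {(i v, v) |v. v \<in> W \<union> Y}"
  have AK: "(p, q) \<in> A\<^sup>*" if "p \<in> K" "q \<in> K" for p q
  proof -
    have "(p, q) \<in> A1\<^sup>*" using core(1) that unfolding core_def A1_def by blast
    then show ?thesis by (rule rtrancl_mono[THEN subsetD, rotated]) (auto simp: A_def)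
  qed
  have AW: "(w, q) \<in> A\<^sup>*" if "w \<in> K \<union> W" "q \<in> K" for w q
  proof (cases "w \<in> K")
    case False
    then have "(w, out w) \<in> A" "out w \<in> K" using that oi[of w] by (auto simp: A_def A2_def)
    then show ?thesis using AK[OF _ that(2)] by (meson converse_rtrancl_into_rtrancl)
  qed (use AK that in simp)
  have AX: "(x, q) \<in> A\<^sup>*" if "x \<in> X" "q \<in> K" for x q
  proof -
    have x0': "x0 \<in> X" "r \<in> K \<union> W" using x0 that by auto
    then have "(x0, r) \<in> A" by (auto simp: A_def A3_def)
    then have *: "(x0, q) \<in> A\<^sup>*" using AW[OF x0'(2) that(2)] by (rule converse_rtrancl_into_rtrancl)
    show ?thesis
    proof (cases "x = x0")
      case False
      then have "(x, x0) \<in> A" using that by (auto simp: A_def A4_def)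
      then show ?thesis using * by (rule converse_rtrancl_into_rtrancl)
    qed (use * in simp)
  qed
  \<comment> \<open>The route goes along \<open>A\<close> into the core, through it to the entry
    vertex \<open>i y\<close>, and ends with one arc of \<open>B\<close>.\<close>
  have reach: "(x, y) \<in> A\<^sup>* O B\<^sup>=" if "x \<in> K \<union> W \<union> X" "y \<in> K \<union> W \<union> Y" for x y
  proof (cases "y \<in> K")
    case True
    then show ?thesis using AW[of x y] AX[of x y] that by auto
  next
    case False
    then have y: "y \<in> W \<union> Y" using that by blast
    then have "(x, i y) \<in> A\<^sup>*" using AW[of x "i y"] AX[of x "i y"] that i by auto
    moreover have "(i y, y) \<in> B" using y by (auto simp: B_def)
    ultimately show ?thesis by blast
  qed
  show ?thesis
  proof (rule increasing_coloring[where A = A and B = B and lab = l])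
    fix x y assume "(x, y) \<in> A"
    then consider "(x, y) \<in> A1" | "(x, y) \<in> A2" | "(x, y) \<in> A3" | "(x, y) \<in> A4"
      unfolding A_def by blast
    then show "{x, y} \<in> E \<and> x \<in> V \<and> y \<in> V \<and> l y mod 3 = Suc (l x) mod 3"
    proof cases
      case 1
      then show ?thesis using lK core(2) by (auto simp: A1_def label_arcs_def)
    next
      case 2
      then have "x \<in> W" "y = out x" by (auto simp: A2_def)
      then show ?thesis using oi[of x] lW[of x] lK[of y] V by simp
    next
      case 3
      then have x: "x \<in> X" "x = x0" "y = r" by (auto simp: A3_def)
      then have ne: "X \<noteq> {}" by blast
      have "l x = l r + 2" using x lr[OF ne] by (simp add: l_def)
      then show ?thesis using x x0[OF ne] V by auto
    next
      case 4
      then have x: "x \<in> X" "x \<noteq> x0" "y = x0" by (auto simp: A4_def)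
      then have "x0 \<in> X" using x0 by blast
      then have "l x = l x0 + 2" using x by (simp add: l_def)
      then show ?thesis using x \<open>x0 \<in> X\<close> X[of x x0] V by simp
    qed
  next
    fix x y assume "(x, y) \<in> B"
    then have xy: "x = i y" "y \<in> W \<union> Y" by (auto simp: B_def)
    have ix: "x \<in> K" "{x, y} \<in> E" using i[OF xy(2)] xy(1) by auto
    have yK: "y \<notin> K" "y \<notin> X" using xy(2) dis by auto
    have "(y, x) \<notin> A1" using yK by (simp add: A1_def label_arcs_def)
    \<comment> \<open>This is where the two chosen neighbors of a vertex of \<open>W\<close> must
      differ: an edge cannot serve for both leaving and entering.\<close>
    moreover have "(y, x) \<notin> A2" using iW xy by (auto simp: A2_def)
    moreover have "(y, x) \<notin> A3" "(y, x) \<notin> A4" using yK by (auto simp: A3_def A4_def)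
    moreover have "(y, x) \<notin> B" using yK i by (auto simp: B_def)
    ultimately show "{x, y} \<in> E \<and> x \<in> V \<and> y \<in> V \<and> (y, x) \<notin> A \<union> B"
      using ix xy(2) V by (auto simp: A_def)
  next
    fix x y assume xy: "x \<in> V" "y \<in> V" "x \<noteq> y"
    then consider "x \<in> K \<union> W \<union> X" "y \<in> K \<union> W \<union> Y" | "x \<in> Y" "y \<in> Y" | "x \<in> Y" "y \<in> K \<union> W \<union> X"
      | "x \<in> X" "y \<in> X" | "y \<in> X" "x \<in> K \<union> W" unfolding V by blast
    then show "{x, y} \<in> E \<or> (x, y) \<in> A\<^sup>* O B\<^sup>= \<or> (y, x) \<in> A\<^sup>* O B\<^sup>="
    proof cases
      case 1
      then show ?thesis using reach by blast
    next
      case 2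
      then show ?thesis using Y xy(3) by blast
    next
      case 3
      then have "(y, x) \<in> A\<^sup>* O B\<^sup>=" by (intro reach) auto
      then show ?thesis by blast
    next
      case 4
      then show ?thesis using X xy(3) by blast
    next
      case 5
      then have "(y, x) \<in> A\<^sup>* O B\<^sup>=" by (intro reach) auto
      then show ?thesis by blast
    qed
  qed
qed

section \<open>Largest cores\<close>

text \<open>If \<open>a\<close> had \<open>t\<close> as its only neighbor in the core, strong
  connectivity would require arcs both ways between them, which labels modulo 3 exclude. So a
  three-vertex core is a triangle.\<close>

lemma core3_adjacent:
  assumes core: "core E K lab" and K: "K = {a, b, t}" "a \<noteq> b" "a \<noteq> t"
  shows "{a, b} \<in> E"
proof (rule ccontr)
  assume n: "{a, b} \<notin> E"
  let ?D = "label_arcs E K lab"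
  have irr: "(x, x) \<notin> ?D" for x
    using mod3_Suc_neq[of "lab x" "lab x"] by (auto simp: label_arcs_def)
  have only: "k = t" if "(a, k) \<in> ?D \<or> (k, a) \<in> ?D" for k
    using that n irr[of a] K(1) by (auto simp: label_arcs_def insert_commute)
  have "(a, t) \<in> ?D\<^sup>*" "(t, a) \<in> ?D\<^sup>*" using core K(1) unfolding core_def by blast+
  then obtain k k' where "(a, k) \<in> ?D" "(k', a) \<in> ?D"
    using K(3) by (metis converse_rtranclE rtranclE)
  then have "(a, t) \<in> ?D" "(t, a) \<in> ?D" using only by blast+
  then have "lab t mod 3 = Suc (lab a) mod 3" "lab a mod 3 = Suc (lab t) mod 3"
    by (auto simp: label_arcs_def)
  from mod3_Suc_Suc_neq[OF this] show False by simp
qed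

text \<open>Stated for an edge set \<open>E\<close> and its complement \<open>F\<close>, so that it
  applies whichever graph contains the largest core. If \<open>D\<close> is not a clique, maximality
  leaves at most one vertex in \<open>D\<close> besides a nonadjacent pair
  \<open>x, y\<close>.\<close>

lemma maximal_core_coloring:
  assumes fin: "finite V"
    and EF: "\<And>x y. x \<in> V \<Longrightarrow> y \<in> V \<Longrightarrow> x \<noteq> y \<Longrightarrow> {x, y} \<in> F \<longleftrightarrow> {x, y} \<notin> E"
    and conn: "connected_graph V E"
    and K: "core E K lab" "K \<subseteq> V" "3 \<le> card K"
    and maxE: "\<And>L lab. L \<subseteq> V \<Longrightarrow> core E L lab \<Longrightarrow> card L \<le> card K"
    and maxF: "\<And>L lab. L \<subseteq> V \<Longrightarrow> core F L lab \<Longrightarrow> card L \<le> card K"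
  shows "\<exists>c :: 'a set \<Rightarrow> nat. proper_connecting_coloring V E c \<and> range c \<subseteq> {0, 1, 2}"
proof -
  define N where "N x y \<longleftrightarrow> {x, y} \<in> E" for x y
  define M where "M x y \<longleftrightarrow> {x, y} \<in> F" for x y
  have Nc: "N x y \<longleftrightarrow> N y x" and Mc: "M x y \<longleftrightarrow> M y x" for x y
    unfolding N_def M_def by (simp_all add: insert_commute)
  have MN: "M x y \<longleftrightarrow> \<not> N x y" if "x \<in> V" "y \<in> V" "x \<noteq> y" for x y
    using EF[OF that] by (simp add: N_def M_def)
  have finK: "finite K" using fin K(2) finite_subset by blast
  have Kne: "K \<noteq> {}" using K(3) by auto
  define D where "D = {v \<in> V - K. \<not> (\<exists>p\<in>K. \<exists>q\<in>K. p \<noteq> q \<and> N v p \<and> N v q)}"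
  define W where "W = V - K - D"
  have W: "\<exists>p\<in>K. \<exists>q\<in>K. p \<noteq> q \<and> {w, p} \<in> E \<and> {w, q} \<in> E" if "w \<in> W" for w
    using that unfolding W_def D_def N_def by blast
  have D1: "p = q" if "v \<in> D" "p \<in> K" "q \<in> K" "N v p" "N v q" for v p q
    using that unfolding D_def by blast
  have DV: "v \<in> V" "v \<notin> K" if "v \<in> D" for v using that unfolding D_def by auto
  \<comment> \<open>It remains to split \<open>D\<close> into the two cliques required by
    \<open>core_coloring\<close>.\<close>
  have finish: ?thesis
    if X: "\<And>x x'. x \<in> X \<Longrightarrow> x' \<in> X \<Longrightarrow> x \<noteq> x' \<Longrightarrow> N x x'"
    and X_att: "X \<noteq> {} \<Longrightarrow> \<exists>x\<in>X. \<exists>r\<in>K \<union> W. N x r"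
    and Y: "\<And>y y'. y \<in> Y \<Longrightarrow> y' \<in> Y \<Longrightarrow> y \<noteq> y' \<Longrightarrow> N y y'"
    and Y_att: "\<And>y. y \<in> Y \<Longrightarrow> \<exists>k\<in>K. N y k"
    and XY: "D = X \<union> Y" "X \<inter> Y = {}" for X Y
  proof (rule core_coloring[OF K(1,2) Kne W, of W X Y])
    show "V = K \<union> W \<union> X \<union> Y" using K(2) XY(1) unfolding W_def D_def by blast
    show "K \<inter> W = {}" "K \<inter> X = {}" "K \<inter> Y = {}" "W \<inter> X = {}" "W \<inter> Y = {}"
      using XY(1) DV unfolding W_def by blast+
  qed (use X X_att Y Y_att XY(2) in \<open>unfold N_def, blast+\<close>)
  show ?thesis
  proof (cases "\<forall>x\<in>D. \<forall>y\<in>D. x \<noteq> y \<longrightarrow> N x y")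
    case True
    show ?thesis
    proof (rule finish[of D "{}"])
      assume "D \<noteq> {}"
      have "K \<union> W \<subseteq> V" "K \<union> W \<noteq> {}" "K \<union> W \<noteq> V"
        using K(2) Kne \<open>D \<noteq> {}\<close> DV unfolding W_def by blast+
      then obtain p w where "p \<in> K \<union> W" "w \<in> V" "w \<notin> K \<union> W" "{p, w} \<in> E"
        using connected_boundary_edge[OF conn] by metis
      then have "w \<in> D" "N w p" unfolding W_def N_def by (auto simp: insert_commute)
      then show "\<exists>x\<in>D. \<exists>r\<in>K \<union> W. N x r" using \<open>p \<in> K \<union> W\<close> by blast
    qed (use True in auto)
  next
    case False
    then obtain x y where xy: "x \<in> D" "y \<in> D" "x \<noteq> y" "\<not> N x y" by blast
    have xyV: "x \<in> V" "y \<in> V" "x \<notin> K" "y \<notin> K" using DV xy by auto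
    have Mxy: "M x y" using MN xyV xy by blast
    define S where "S = {k \<in> K. N x k \<or> N y k}"
    define T where "T = K - S"
    \<comment> \<open>At this point \<open>s\<close> is only the sole candidate for a neighbor; that
      \<open>sx\<close> and \<open>sy\<close> really are neighbors follows once
      \<open>card S = 2\<close> is known.\<close>
    have nbx: "\<exists>s. \<forall>k\<in>K. N x k \<longrightarrow> k = s" using D1[OF xy(1)] by metis
    have nby: "\<exists>s. \<forall>k\<in>K. N y k \<longrightarrow> k = s" using D1[OF xy(2)] by metis
    obtain sx sy where sx: "\<And>k. k \<in> K \<Longrightarrow> N x k \<Longrightarrow> k = sx"
      and sy: "\<And>k. k \<in> K \<Longrightarrow> N y k \<Longrightarrow> k = sy" using nbx nby by blast
    have Ssub: "S \<subseteq> {sx, sy}" using sx sy unfolding S_def by blast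
    have S2: "card S \<le> 2"
      using card_mono[OF _ Ssub] by (simp add: card_insert_if split: if_splits)
    have SK: "S \<subseteq> K" by (auto simp: S_def)
    have cT: "card T + card S = card K"
      unfolding T_def using card_Diff_subset[of S K] card_mono[OF finK SK] finite_subset[OF SK finK] SK by simp
    then have "card T \<noteq> 0" using S2 K(3) by linarith
    then have Tne: "T \<noteq> {}" by auto
    have finT: "finite T" using finK by (simp add: T_def)
    have TV: "t \<in> V" "t \<in> K" "t \<noteq> x" "t \<noteq> y" if "t \<in> T" for t
      using that K(2) xyV unfolding T_def by auto
    have MT: "M x t" "M y t" if "t \<in> T" for t
    proof -
      have "\<not> N x t" "\<not> N y t" using that unfolding T_def S_def by auto
      then show "M x t" "M y t" using MN TV[OF that] xyV by metis+
    qed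
    define K' where "K' = {x, y} \<union> T"
    define lab' :: "'a \<Rightarrow> nat" where "lab' = (\<lambda>_. 2)(x := 0, y := 1)"
    have lab': "lab' x = 0" "lab' y = 1" "\<And>t. t \<in> T \<Longrightarrow> lab' t = 2"
      using xy(3) TV by (auto simp: lab'_def)
    have coreF: "core F K' lab'" unfolding K'_def lab'_def
      by (rule core_triangle) (use Mxy xy Tne TV MT in \<open>auto simp: M_def\<close>)
    have K'V: "K' \<subseteq> V" using xyV TV unfolding K'_def by blast
    have "x \<notin> T" "y \<notin> T" using TV by blast+
    then have cK': "card K' = card T + 2" using xy(3) finT unfolding K'_def by simp
    have "card K' \<le> card K" using maxF[OF K'V coreF] .
    \<comment> \<open>Maximality gives \<open>card T + 2 \<le> card K = card T + card S\<close>, so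
      \<open>S\<close> has exactly two elements and \<open>K'\<close> is a largest core as
      well.\<close>
    then have cS: "card S = 2" and cKK': "card K' = card K" using cT cK' S2 by linarith+
    have ss: "sx \<noteq> sy" "S = {sx, sy}"
    proof -
      show "sx \<noteq> sy"
      proof
        assume "sx = sy"
        then have "card S \<le> card {sx}" using Ssub by (intro card_mono) auto
        then show False using cS by simp
      qed
      then have "card {sx, sy} = 2" by simp
      then show "S = {sx, sy}" using Ssub cS by (intro card_seteq) auto
    qed
    have s: "sx \<in> K" "sy \<in> K" "N x sx" "N y sy" "\<not> N x sy" "\<not> N y sx"
    proof -
      show k: "sx \<in> K" "sy \<in> K" using ss(2) SK by auto
      show n: "\<not> N x sy" "\<not> N y sx" using sx[OF k(2)] sy[OF k(1)] ss(1) by auto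
      have "sx \<in> S" "sy \<in> S" using ss(2) by auto
      then show "N x sx" "N y sy" using n unfolding S_def by auto
    qed
    have sV: "sx \<in> V" "sy \<in> V" "sx \<notin> T" "sy \<notin> T" "sx \<noteq> x" "sx \<noteq> y" "sy \<noteq> x" "sy \<noteq> y"
      using s K(2) ss xyV unfolding T_def by auto
    \<comment> \<open>Otherwise \<open>core_insert\<close> would enlarge the largest core
      \<open>K'\<close>.\<close>
    have noF: "\<not> (M p w \<and> M q w)" if w: "w \<in> V" "w \<notin> K'" "p \<in> K'" "q \<in> K'" "lab' p mod 3 \<noteq> lab' q mod 3" for p q w
    proof
      assume "M p w \<and> M q w"
      then obtain l where l: "core F (insert w K') l"
        using core_insert[OF coreF w(3,4,2) _ _ w(5)] unfolding M_def by blast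
      have "card (insert w K') \<le> card K" using maxF[OF _ l] that(1) K'V by blast
      moreover have "card (insert w K') = Suc (card K')"
        using that(2) finite_subset[OF K'V fin] by simp
      ultimately show False using cKK' by simp
    qed
    have noT: "\<not> (M x w \<and> M t w)" "\<not> (M y w \<and> M t w)" if "w \<in> V" "w \<notin> K'" "t \<in> T" for w t
      using noF[OF that(1,2), of x t] noF[OF that(1,2), of y t] that(3) lab' unfolding K'_def by auto
    have noxy: "\<not> (M x w \<and> M y w)" if "w \<in> V" "w \<notin> K'" for w
      using noF[OF that, of x y] lab' unfolding K'_def by auto
    have sK': "sx \<notin> K'" "sy \<notin> K'" using sV unfolding K'_def by auto
    \<comment> \<open>In \<open>F\<close>, \<open>sx\<close> is adjacent to \<open>y\<close> and
      \<open>sy\<close> to \<open>x\<close>; a further \<open>F\<close>-neighbor in \<open>T\<close>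
      would have a different label.\<close>
    have sxT: "N sx t" and syT: "N sy t" if "t \<in> T" for t
    proof -
      have "M y sx" "M x sy" using MN s sV xyV by metis+
      then have "\<not> M t sx" "\<not> M t sy"
        using noT(2)[OF sV(1) sK'(1) that] noT(1)[OF sV(2) sK'(2) that] by blast+
      moreover have "t \<noteq> sx" "t \<noteq> sy" using sV that by auto
      ultimately show "N sx t" "N sy t" using MN[OF TV(1)[OF that]] sV Nc by metis+
    qed
    have cK: "card K = card T + 2" using cT cS by simp
    have z: "\<not> (N x z \<and> N y z)" "N x z \<or> N y z" "\<And>t. t \<in> T \<Longrightarrow> N z t"
      if z: "z \<in> V" "z \<notin> K" "z \<noteq> x" "z \<noteq> y" for z
    proof -
      have zd: "z \<notin> T" "z \<noteq> sx" "z \<noteq> sy" using z s unfolding T_def by auto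
      show n1: "\<not> (N x z \<and> N y z)"
      proof
        assume n: "N x z \<and> N y z"
        \<comment> \<open>A common neighbor \<open>z\<close> closes hexagons through
          \<open>T\<close>. They form a core with \<open>card T + 5\<close> vertices, more than
          \<open>card K = card T + 2\<close>.\<close>
        have "\<exists>l. core E ({sx, x, z, y, sy} \<union> T) l"
        proof (rule core_hexagon)
          show "{sx, x} \<in> E" "{x, z} \<in> E" "{z, y} \<in> E" "{y, sy} \<in> E"
            using n s(3,4) unfolding N_def by (simp_all add: insert_commute)
          show "distinct [sx, x, z, y, sy]" using z zd sV ss(1) xy(3) by auto
          show "{sx, x, z, y, sy} \<inter> T = {}" using zd sV TV by auto
          show "{sy, t} \<in> E \<and> {sx, t} \<in> E" if "t \<in> T" for t
            using sxT[OF that] syT[OF that] by (simp add: N_def)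
        qed (use Tne in simp)
        then obtain l where "core E ({sx, x, z, y, sy} \<union> T) l" by blast
        moreover have "{sx, x, z, y, sy} \<union> T \<subseteq> V" using z sV xyV TV by blast
        ultimately have "card ({sx, x, z, y, sy} \<union> T) \<le> card K" using maxE by blast
        moreover have "card ({sx, x, z, y, sy} \<union> T) = card {sx, x, z, y, sy} + card T"
          by (rule card_Un_disjoint) (use finT zd sV TV in auto)
        moreover have "card {sx, x, z, y, sy} = 5" using z zd sV ss(1) xy(3) by auto
        ultimately show False using cK by simp
      qed
      have zK': "z \<notin> K'" using z zd unfolding K'_def by auto
      have MNz: "M x z \<longleftrightarrow> \<not> N x z" "M y z \<longleftrightarrow> \<not> N y z" using MN z xyV by metis+
      show "N x z \<or> N y z" using noxy[OF z(1) zK'] MNz by blast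
      show "N z t" if "t \<in> T" for t
      proof -
        have "\<not> M t z" using noT[OF z(1) zK' that] n1 MNz by blast
        moreover have "t \<noteq> z" using zd that by blast
        ultimately show ?thesis using MN[OF TV(1)[OF that] z(1)] Nc by blast
      qed
    qed
    have zD: "z \<in> V" "z \<notin> K" "z \<noteq> x" "z \<noteq> y" if "z \<in> D - {x, y}" for z
      using that DV by auto
    \<comment> \<open>Vertices of \<open>D\<close> have at most one neighbor in \<open>K\<close>,
      yet \<open>z\<close> is adjacent to all of \<open>T\<close>. So \<open>T\<close> is a single
      vertex, \<open>K\<close> has three, and any four-vertex core in either graph is a
      contradiction.\<close>
    have uniq: "z = z'" if zz: "z \<in> D - {x, y}" "z' \<in> D - {x, y}" for z z'
    proof (rule ccontr)
      assume ne: "z \<noteq> z'"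
      note z1 = zD[OF zz(1)] and z2 = zD[OF zz(2)]
      obtain t where t: "t \<in> T" using Tne by blast
      have nt: "N z t" "N z' t" using z(3)[OF z1 t] z(3)[OF z2 t] .
      have only: "k = t" if "k \<in> K" "N w k" "w = z \<or> w = z'" for k w
        using D1[of w k t] that zz nt TV(2)[OF t] by auto
      have "T = {t}" using only[OF TV(2)] z(3)[OF z1] t by blast
      then have K3: "card K = 3" "K = {sx, sy, t}" using cK ss SK unfolding T_def by auto
      have st: "sx \<noteq> t" "sy \<noteq> t" using sV t by auto
      have no4: "\<not> (\<exists>l. core E L l)" "\<not> (\<exists>l. core F L l)" if "L \<subseteq> V" "card L \<ge> 4" for L
        using maxE[OF that(1)] maxF[OF that(1)] that(2) K3(1) by fastforce+
      have Ms: "M w sx" "M w sy" if "w = z \<or> w = z'" for w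
        using only[of sx w] only[of sy w] st s that z1 z2 sV MN[of w sx] MN[of w sy] by auto
      have zn: "z \<noteq> sx" "z \<noteq> sy" "z \<noteq> t" "z' \<noteq> sx" "z' \<noteq> sy" "z' \<noteq> t" "x \<noteq> t" "y \<noteq> t"
        using z1 z2 s TV[OF t] by auto
      have tV: "t \<in> V" using TV[OF t] by simp
      have nzz: "N z z'"
      proof (rule ccontr)
        assume "\<not> N z z'"
        then have "M z z'" using MN z1 z2 ne by blast
        have "core F ({z, z'} \<union> {sx, sy}) ((\<lambda>_. 2)(z := 0, z' := 1))"
          by (rule core_triangle) (use \<open>M z z'\<close> Ms ne zn in \<open>auto simp: M_def\<close>)
        moreover have "card ({z, z'} \<union> {sx, sy}) = 4" using ne zn ss(1) by simp
        ultimately show False using no4(2)[of "{z, z'} \<union> {sx, sy}"] z1 z2 sV by auto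
      qed
      have both: False if "N w z" "N w z'" "w = x \<or> w = y" for w
      proof -
        have wn: "w \<in> V" "w \<noteq> z" "w \<noteq> z'" "w \<noteq> t" using that(3) xyV z1 z2 zn by auto
        have "core E ({z, z'} \<union> {t, w}) ((\<lambda>_. 2)(z := 0, z' := 1))"
          by (rule core_triangle) (use nzz nt that(1,2) ne zn wn in \<open>auto simp: N_def insert_commute\<close>)
        moreover have "card ({z, z'} \<union> {t, w}) = 4" using ne zn wn by simp
        ultimately show False using no4(1)[of "{z, z'} \<union> {t, w}"] z1 z2 tV wn by auto
      qed
      have adj: "{sy, sx} \<in> E" using core3_adjacent[OF K(1) K3(2) ss(1) st(1)] by (simp add: insert_commute)
      \<comment> \<open>The 6-cycle is \<open>sx, x, p, q, y, sy\<close>, closed by the edge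
        \<open>adj\<close>.\<close>
      have hex: False if "N x p" "N y q" "N p q" "p \<in> {z, z'}" "q \<in> {z, z'}" "p \<noteq> q" for p q
      proof -
        have "\<exists>l. core E ({sx, x, p, q, y} \<union> {sy}) l"
        proof (rule core_hexagon)
          show "{sx, x} \<in> E" "{x, p} \<in> E" "{p, q} \<in> E" "{q, y} \<in> E"
            using that(1-3) s(3) unfolding N_def by (simp_all add: insert_commute)
          show "distinct [sx, x, p, q, y]" using that(4-6) z1 z2 zn sV xy(3) by auto
          show "{sx, x, p, q, y} \<inter> {sy} = {}" using that(4,5) zn sV ss(1) by auto
          show "{y, k} \<in> E \<and> {sx, k} \<in> E" if "k \<in> {sy}" for k
            using that adj s(4) unfolding N_def by (simp add: insert_commute)
        qed simp
        moreover have "card ({sx, x, p, q, y} \<union> {sy}) \<ge> 4"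
        proof -
          have "card {x, y, sx, sy} = 4" using sV ss(1) xy(3) by simp
          then show ?thesis using card_mono[of "{sx, x, p, q, y} \<union> {sy}" "{x, y, sx, sy}"] by auto
        qed
        moreover have "{sx, x, p, q, y} \<union> {sy} \<subseteq> V" using that(4,5) z1 z2 sV xyV by auto
        ultimately show False using no4(1) by blast
      qed
      \<comment> \<open>Each of \<open>z\<close> and \<open>z'\<close> is adjacent to
        \<open>x\<close> or \<open>y\<close>: a shared choice contradicts \<open>both\<close>,
        different choices contradict \<open>hex\<close>.\<close>
      show False
        using z(2)[OF z1] z(2)[OF z2] both[of x] both[of y] hex[of z z'] hex[of z' z] nzz Nc ne
        by blast
    qed
    show ?thesis
    proof (cases "D - {x, y} = {}")
      case True
      show ?thesis
        by (rule finish[of "{x}" "{y}"]) (use True xy s in auto)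
    next
      case False
      then obtain z0 where z0: "z0 \<in> D - {x, y}" by blast
      then have D: "D = {x, y, z0}" using uniq xy by blast
      note z0' = zD[OF z0]
      show ?thesis
      \<comment> \<open>The vertex \<open>z0\<close> joins the clique of its neighbor among
        \<open>x\<close> and \<open>y\<close>. That clique is taken as the outgoing part
        \<open>X\<close>, where one attachment suffices.\<close>
      proof (cases "N x z0")
        case True
        show ?thesis
          by (rule finish[of "{x, z0}" "{y}"]) (use True D xy s z0' Nc[of x z0] in auto)
      next
        case False
        then have "N y z0" using z(2)[OF z0'] by blast
        then show ?thesis
          by (intro finish[of "{y, z0}" "{x}"]) (use D xy s z0' Nc[of y z0] in auto)
      qed
    qed
  qed
qed

section \<open>Triangles in a graph or its complement\<close>

text \<open>The bound R(3,3) \<le> 6: among at least five other vertices, three are joined to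
  \<open>v\<close> in the same way, and either two of them complete a triangle with \<open>v\<close>
  or all three form one of the other kind.\<close>

lemma monochromatic_triangle:
  fixes N M :: "'a \<Rightarrow> 'a \<Rightarrow> bool"
  assumes fin: "finite V" and V6: "card V \<ge> 6"
    and NM: "\<And>x y. x \<in> V \<Longrightarrow> y \<in> V \<Longrightarrow> x \<noteq> y \<Longrightarrow> N x y \<or> M x y"
  shows "\<exists>a\<in>V. \<exists>b\<in>V. \<exists>c\<in>V. distinct [a, b, c] \<and> (N a b \<and> N a c \<and> N b c \<or> M a b \<and> M a c \<and> M b c)"
proof -
  have key: ?thesis
    if v: "v \<in> V" and U: "U \<subseteq> V - {v}" "card U \<ge> 3"
      and P: "P = N \<and> Q = M \<or> P = M \<and> Q = N" and PU: "\<And>w. w \<in> U \<Longrightarrow> P v w" for v U P Q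
  proof -
    obtain T where "T \<subseteq> U" "card T = 3" using U(2) obtain_subset_with_card_n by metis
    then obtain a b c where abc: "a \<in> U" "b \<in> U" "c \<in> U" "a \<noteq> b" "a \<noteq> c" "b \<noteq> c"
      by (auto simp: card_3_iff)
    have inV: "a \<in> V" "b \<in> V" "c \<in> V" "v \<noteq> a" "v \<noteq> b" "v \<noteq> c" using abc U(1) by auto
    have PQ: "P x y \<or> Q x y" if "x \<in> V" "y \<in> V" "x \<noteq> y" for x y
      using NM[OF that] P by blast
    have "\<exists>a\<in>V. \<exists>b\<in>V. \<exists>c\<in>V. distinct [a, b, c] \<and> (P a b \<and> P a c \<and> P b c \<or> Q a b \<and> Q a c \<and> Q b c)"
    proof (cases "P a b \<or> P a c \<or> P b c")
      case True
      then obtain d e where "d \<in> {a, b, c}" "e \<in> {a, b, c}" "P d e" "d \<noteq> e" using abc by blast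
      moreover from this have "d \<in> V" "e \<in> V" "v \<noteq> d" "v \<noteq> e" "P v d" "P v e"
        using inV PU abc by auto
      ultimately have "distinct [v, d, e] \<and> (P v d \<and> P v e \<and> P d e \<or> Q v d \<and> Q v e \<and> Q d e)"
        by simp
      then show ?thesis using v \<open>d \<in> V\<close> \<open>e \<in> V\<close> by blast
    next
      case False
      then have "Q a b" "Q a c" "Q b c" using PQ inV abc by blast+
      then have "distinct [a, b, c] \<and> (P a b \<and> P a c \<and> P b c \<or> Q a b \<and> Q a c \<and> Q b c)"
        using abc by simp
      then show ?thesis using inV by blast
    qed
    then show ?thesis using P by blast
  qed
  obtain v where v: "v \<in> V" using V6 by fastforce
  let ?N = "{w \<in> V - {v}. N v w}" and ?M = "{w \<in> V - {v}. M v w}"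
  have "V - {v} \<subseteq> ?N \<union> ?M" using NM v by blast
  then have "card (V - {v}) \<le> card (?N \<union> ?M)" using fin by (intro card_mono) auto
  also have "\<dots> \<le> card ?N + card ?M" by (rule card_Un_le)
  finally have "card ?N + card ?M \<ge> 5" using v V6 fin by simp
  then consider "card ?N \<ge> 3" | "card ?M \<ge> 3" by linarith
  then show ?thesis
  proof cases
    case 1
    then show ?thesis by (intro key[OF v, of ?N N M]) auto
  next
    case 2
    then show ?thesis by (intro key[OF v, of ?M M N]) auto
  qed
qed

text \<open>The triangle makes the largest core over both graphs have at least three vertices; the
  graph that contains this core is the one colored with three colors.\<close>

lemma pc12_le_3_or_complement:
  assumes fin: "finite V" and V6: "card V \<ge> 6"
    and conn: "connected_graph V E" "connected_graph V (complement_edges V E)"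
  shows "pc12 V E \<le> 3 \<or> pc12 V (complement_edges V E) \<le> 3"
proof -
  let ?F = "complement_edges V E"
  define P where "P K \<longleftrightarrow> K \<subseteq> V \<and> ((\<exists>l. core E K l) \<or> (\<exists>l. core ?F K l))" for K
  have EF: "{x, y} \<in> ?F \<longleftrightarrow> {x, y} \<notin> E" if "x \<in> V" "y \<in> V" "x \<noteq> y" for x y
    using that by (simp add: mem_complement_edges)
  have tri: "\<exists>l. core E' {a, b, c} l"
    if "{a, b} \<in> E'" "{a, c} \<in> E'" "{b, c} \<in> E'" "distinct [a, b, c]" for a b c and E' :: "'a set set"
    using core_triangle[of a b E' "{c}"] that by (auto simp: insert_commute)
  obtain a b c where abc: "a \<in> V" "b \<in> V" "c \<in> V" "distinct [a, b, c]"
    "{a, b} \<in> E \<and> {a, c} \<in> E \<and> {b, c} \<in> E \<or> {a, b} \<in> ?F \<and> {a, c} \<in> ?F \<and> {b, c} \<in> ?F"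
    using monochromatic_triangle[OF fin V6, of "\<lambda>x y. {x, y} \<in> E" "\<lambda>x y. {x, y} \<in> ?F"] EF by blast
  have P3: "P {a, b, c}" "card {a, b, c} = 3"
    using abc tri[of a b E c] tri[of a b ?F c] unfolding P_def by auto
  have bound: "\<forall>K. P K \<longrightarrow> card K < Suc (card V)"
    using card_mono[OF fin] unfolding P_def less_Suc_eq_le by blast
  obtain K where K: "P K" "\<And>L. P L \<Longrightarrow> card L \<le> card K"
    using ex_has_greatest_nat[OF P3(1) bound] by blast
  have K3: "3 \<le> card K" using K(2)[OF P3(1)] P3(2) by simp
  have max: "card L \<le> card K" if "L \<subseteq> V" "core E L l \<or> core ?F L l" for L l
    using K(2) that unfolding P_def by blast
  have le3: "pc12 V E' \<le> 3"
    if "\<exists>c :: 'a set \<Rightarrow> nat. proper_connecting_coloring V E' c \<and> range c \<subseteq> {0, 1, 2}" for E'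
    using that pc12_le card_image_le_if_range3 by metis
  have KV: "K \<subseteq> V" using K(1) unfolding P_def by blast
  from K(1) consider l where "core E K l" | l where "core ?F K l" unfolding P_def by blast
  then show ?thesis
  proof cases
    case 1
    have "pc12 V E \<le> 3"
      by (rule le3[OF maximal_core_coloring[OF fin EF conn(1) 1 KV K3]]) (use max in blast)+
    then show ?thesis ..
  next
    case 2
    have "pc12 V ?F \<le> 3"
      by (rule le3[OF maximal_core_coloring[OF fin _ conn(2) 2 KV K3, of E]]) (use max EF in blast)+
    then show ?thesis ..
  qed
qed

section \<open>Combination of the bounds\<close>

lemma complement_complement_edges:
  assumes "fin_sgraph V E"
  shows "complement_edges V (complement_edges V E) = E"
  using assms unfolding fin_sgraph_def complement_edges_def by blast

lemma fin_sgraph_complement: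
  assumes "fin_sgraph V E"
  shows "fin_sgraph V (complement_edges V E)"
  using assms unfolding fin_sgraph_def complement_edges_def by blast

lemma pc12_sum_double_star:
  assumes "fin_sgraph V E" "connected_graph V E" "is_double_star V E"
  shows "pc12 V E + pc12 V (complement_edges V E) = card V + 2"
proof -
  have fin: "finite V" using assms(1) by (simp add: fin_sgraph_def)
  obtain u v A B where ds: "double_star_with V E u v A B"
    using is_double_star_imp_double_star_with[OF assms(1,3)] by blast
  show ?thesis
    using pc12_double_star[OF fin assms(2) ds] pc12_complement_double_star[OF fin ds] by simp
qed

theorem theorem4p2:
  fixes V :: "'a set" and E :: "'a set set" and n :: nat
  assumes "fin_sgraph V E"
    and "card V = n"
    and "n \<ge> 2"
    and "connected_graph V E"
    and "connected_graph V (complement_edges V E)"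
  shows "pc12 V E + pc12 V (complement_edges V E) \<le> n + 2 \<and>
    (pc12 V E + pc12 V (complement_edges V E) = n + 2 \<longleftrightarrow>
       is_double_star V E \<or> is_double_star V (complement_edges V E))"
proof (cases "is_double_star V E \<or> is_double_star V (complement_edges V E)")
  case True
  have "pc12 V E + pc12 V (complement_edges V E) = n + 2"
    using True
  proof
    assume "is_double_star V E"
    then show ?thesis using pc12_sum_double_star assms by blast
  next
    assume "is_double_star V (complement_edges V E)"
    then show ?thesis
      using pc12_sum_double_star[OF fin_sgraph_complement[OF assms(1)] assms(5)] assms(2)
      by (simp add: complement_complement_edges[OF assms(1)])
  qed
  then show ?thesis using True by simp
next
  case False
  let ?F = "complement_edges V E"
  have fin: "finite V" using assms(1) by (simp add: fin_sgraph_def)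
  \<comment> \<open>Neither graph is a double star, so both contain a five-vertex path and save two
    colors.\<close>
  have E5: "has_path5 V E"
    using double_star_if_no_path5[OF assms(1)] double_star_with_imp_is_double_star[OF fin] assms False
    by blast
  have F5: "has_path5 V ?F"
    using double_star_if_no_path5[OF fin_sgraph_complement[OF assms(1)]]
      double_star_with_imp_is_double_star[OF fin] assms False
    by (metis complement_complement_edges)
  have le: "pc12 V E + 2 \<le> n" "pc12 V ?F + 2 \<le> n"
    using pc12_le_if_has_path5[OF fin] assms E5 F5 by blast+
  have "pc12 V E \<le> 3 \<or> pc12 V ?F \<le> 3"
  proof (cases "n \<ge> 6")
    case True
    then show ?thesis using pc12_le_3_or_complement[OF fin] assms by blast
  next
    case False
    \<comment> \<open>For \<open>n \<le> 5\<close> the bound \<open>n - 2\<close> is already at most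
      3.\<close>
    then show ?thesis using le by linarith
  qed
  \<comment> \<open>One summand is at most 3 and the other at most \<open>n - 2\<close>, so equality
    is missed by at least one.\<close>
  then have "pc12 V E + pc12 V ?F \<le> n + 1" using le by linarith
  then show ?thesis using False by simp
qed

end
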